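(* Let $\mathcal{D}\subseteq\mathbb{R}^d$ be compact and let $\boldsymbol{g}:\Omega\times\mathcal{D}\to\mathbb{R}^d$ be a divergence-free Gaussian process with mean $\boldsymbol{m}:\mathcal{D}\to\mathbb{R}^d$ and matrix-valued covariance kernel $\boldsymbol{K}:\mathcal{D}\times\mathcal{D}\to\mathbb{R}^{d\times d}$. Then $\boldsymbol{m}$ is divergence-free, and for every fixed $\boldsymbol{x}'\in\mathcal{D}$ each column of the map $\boldsymbol{x}\mapsto\boldsymbol{K}(\boldsymbol{x},\boldsymbol{x}')$ belongs to $C^1(\mathcal{D})^d$ and is divergence-free. Likewise, for $d\in\{2,3\}$, if $\boldsymbol{g}$ is a rotation-free Gaussian process, then $\boldsymbol{m}$ is rotation-free, and for every fixed $\boldsymbol{x}'\in\mathcal{D}$ each column of $\boldsymbol{x}\mapsto\boldsymbol{K}(\boldsymbol{x},\boldsymbol{x}')$ belongs to $C^1(\mathcal{D})^d$ and is rotation-free.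
   Context: $(\Omega,\mathcal{A},\mathbb{P})$ is a probability space. A function $\boldsymbol{g}:\Omega\times\mathcal{D}\to\mathbb{R}^d$ is a (vector-valued) Gaussian process if for every finite set of pairwise distinct points $\boldsymbol{x}_1,\dots,\boldsymbol{x}_N\in\mathcal{D}$ the random vectors $\boldsymbol{g}(\cdot,\boldsymbol{x}_1),\dots,\boldsymbol{g}(\cdot,\boldsymbol{x}_N)$ have a joint Gaussian distribution. Its mean is $\boldsymbol{m}(\boldsymbol{x})=\mathbb{E}[\boldsymbol{g}(\cdot,\boldsymbol{x})]$ and its covariance kernel is $\boldsymbol{K}(\boldsymbol{x},\boldsymbol{x}')=\mathbb{E}[(\boldsymbol{g}(\cdot,\boldsymbol{x})-\boldsymbol{m}(\boldsymbol{x}))(\boldsymbol{g}(\cdot,\boldsymbol{x}')-\boldsymbol{m}(\boldsymbol{x}'))^{\mathrm T}]$. For a continuously differentiable field $\boldsymbol{v}=(v_1,\dots,v_d)$, $\operatorname{div}\boldsymbol{v}=\sum_{k=1}^d\partial v_k/\partial x_k$; for $d=3$, $\operatorname{curl}\boldsymbol{v}=(\partial_2v_3-\partial_3v_2,\ \partial_3v_1-\partial_1v_3,\ \partial_1v_2-\partial_2v_1)^{\mathrm T}$; for $d=2$, $\operatorname{curl}\boldsymbol{v}=\partial_1v_2-\partial_2v_1$. A field is divergence-free (rotation-free) if its divergence (curl) vanishes identically. A Gaussian process $\boldsymbol{g}:\Omega\times\mathcal{D}\to\mathbb{R}^d$ on a compact set $\mathcal{D}$ which is continuously differentiable with respect to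 $\boldsymbol{x}$ is called divergence-free if $\operatorname{div}\boldsymbol{g}(\cdot,\boldsymbol{x})=0$ for all $\boldsymbol{x}\in\mathcal{D}$ and $\mathbb{P}$-almost everywhere on $\Omega$, and (for $d=2,3$) rotation-free if $\operatorname{curl}\boldsymbol{g}(\cdot,\boldsymbol{x})=0$ for all $\boldsymbol{x}\in\mathcal{D}$ and $\mathbb{P}$-almost everywhere on $\Omega$; the differential operators act on the spatial variable $\boldsymbol{x}$ only. *)

theory Defs
  imports "HOL-Probability.Probability"
begin

text \<open>
  C^1 on a compact set follows the usual convention for C^1 on a closed domain: v is continuous
  on D, differentiable in the interior of D, and its first partial derivatives extend continuously
  to D. The matrix \<open>J x\<close> has entries \<open>J x $ i $ k = \<partial>v\<^sub>i / \<partial>x\<^sub>k\<close>; at a boundary point it is the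
  value of the continuous extension. On the closure of the interior of D, hence on all of D if D
  is the closure of its interior, J is uniquely determined by v. Values of v outside D play no
  role.
\<close>

definition has_C1_jacobian ::
  "(real^'n) set \<Rightarrow> (real^'n \<Rightarrow> real^'n) \<Rightarrow> (real^'n \<Rightarrow> real^'n^'n) \<Rightarrow> bool"
  where "has_C1_jacobian D v J \<longleftrightarrow>
    continuous_on D v \<and> continuous_on D J \<and>
    (\<forall>x\<in>interior D. (v has_derivative (\<lambda>h. J x *v h)) (at x))"

definition C1_on :: "(real^'n) set \<Rightarrow> (real^'n \<Rightarrow> real^'n) \<Rightarrow> bool"
  where "C1_on D v \<longleftrightarrow> (\<exists>J. has_C1_jacobian D v J)"

text \<open>Divergence and curl, as functions of the Jacobian matrix at a point.\<close>

definition jac_div :: "real^'n^'n \<Rightarrow> real"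
  where "jac_div A = (\<Sum>k\<in>UNIV. A $ k $ k)"

definition jac_curl2 :: "real^2^2 \<Rightarrow> real"
  where "jac_curl2 A = A $ 2 $ 1 - A $ 1 $ 2"

definition jac_curl3 :: "real^3^3 \<Rightarrow> real^3"
  where "jac_curl3 A =
    vector [A $ 3 $ 2 - A $ 2 $ 3, A $ 1 $ 3 - A $ 3 $ 1, A $ 2 $ 1 - A $ 1 $ 2]"

definition divergence_free :: "(real^'n) set \<Rightarrow> (real^'n \<Rightarrow> real^'n) \<Rightarrow> bool"
  where "divergence_free D v \<longleftrightarrow>
    (\<exists>J. has_C1_jacobian D v J \<and> (\<forall>x\<in>D. jac_div (J x) = 0))"

definition rotation_free2 :: "(real^2) set \<Rightarrow> (real^2 \<Rightarrow> real^2) \<Rightarrow> bool"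
  where "rotation_free2 D v \<longleftrightarrow>
    (\<exists>J. has_C1_jacobian D v J \<and> (\<forall>x\<in>D. jac_curl2 (J x) = 0))"

definition rotation_free3 :: "(real^3) set \<Rightarrow> (real^3 \<Rightarrow> real^3) \<Rightarrow> bool"
  where "rotation_free3 D v \<longleftrightarrow>
    (\<exists>J. has_C1_jacobian D v J \<and> (\<forall>x\<in>D. jac_curl3 (J x) = 0))"

text \<open>
  Degenerate Gaussian distributions (zero variance, singular covariance) are included. A finite
  family of random vectors is jointly Gaussian if every linear combination of all their components
  is a Gaussian random variable.
\<close>

definition gaussian_real :: "'a measure \<Rightarrow> ('a \<Rightarrow> real) \<Rightarrow> bool"
  where "gaussian_real M Y \<longleftrightarrow> Y \<in> borel_measurable M \<and>
    ((\<exists>\<mu>. AE \<omega> in M. Y \<omega> = \<mu>) \<or>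
     (\<exists>\<mu> \<sigma>. \<sigma> > 0 \<and> distributed M lborel Y (\<lambda>y. ennreal (normal_density \<mu> \<sigma> y))))"

definition jointly_gaussian ::
  "'a measure \<Rightarrow> 'i set \<Rightarrow> ('i \<Rightarrow> 'a \<Rightarrow> 'b::euclidean_space) \<Rightarrow> bool"
  where "jointly_gaussian M I X \<longleftrightarrow>
    (\<forall>i\<in>I. X i \<in> borel_measurable M) \<and>
    (\<forall>c. gaussian_real M (\<lambda>\<omega>. \<Sum>i\<in>I. c i \<bullet> X i \<omega>))"

definition gaussian_process ::
  "'a measure \<Rightarrow> (real^'n) set \<Rightarrow> ('a \<Rightarrow> real^'n \<Rightarrow> real^'n) \<Rightarrow> bool"
  where "gaussian_process M D g \<longleftrightarrow>
    (\<forall>X. finite X \<and> X \<subseteq> D \<longrightarrow> jointly_gaussian M X (\<lambda>x \<omega>. g \<omega> x))"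

definition gp_mean :: "'a measure \<Rightarrow> ('a \<Rightarrow> real^'n \<Rightarrow> real^'n) \<Rightarrow> real^'n \<Rightarrow> real^'n"
  where "gp_mean M g x = (\<integral>\<omega>. g \<omega> x \<partial>M)"

definition gp_cov ::
  "'a measure \<Rightarrow> ('a \<Rightarrow> real^'n \<Rightarrow> real^'n) \<Rightarrow> real^'n \<Rightarrow> real^'n \<Rightarrow> real^'n^'n"
  where "gp_cov M g x x' =
    (\<integral>\<omega>. (\<chi> i j. (g \<omega> x - gp_mean M g x) $ i * (g \<omega> x' - gp_mean M g x') $ j) \<partial>M)"

definition divergence_free_gp ::
  "'a measure \<Rightarrow> (real^'n) set \<Rightarrow> ('a \<Rightarrow> real^'n \<Rightarrow> real^'n) \<Rightarrow> bool"
  where "divergence_free_gp M D g \<longleftrightarrow>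
    gaussian_process M D g \<and> (AE \<omega> in M. divergence_free D (g \<omega>))"

definition rotation_free_gp2 ::
  "'a measure \<Rightarrow> (real^2) set \<Rightarrow> ('a \<Rightarrow> real^2 \<Rightarrow> real^2) \<Rightarrow> bool"
  where "rotation_free_gp2 M D g \<longleftrightarrow>
    gaussian_process M D g \<and> (AE \<omega> in M. rotation_free2 D (g \<omega>))"

definition rotation_free_gp3 ::
  "'a measure \<Rightarrow> (real^3) set \<Rightarrow> ('a \<Rightarrow> real^3 \<Rightarrow> real^3) \<Rightarrow> bool"
  where "rotation_free_gp3 M D g \<longleftrightarrow>
    gaussian_process M D g \<and> (AE \<omega> in M. rotation_free3 D (g \<omega>))"

end

theory Submission
  imports Defs
begin

text \<open>
  The mean and the columns of the covariance kernel have the form \<open>v(x) = E (\<xi> g(x))\<close> with a square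
  integrable weight \<open>\<xi>\<close>. For Gaussian variables \<open>E Y\<^sup>4 \<le> 3 (E Y\<^sup>2)\<^sup>2\<close>. On a linear space of
  variables with this property, pointwise convergence implies convergence in \<open>L\<^sup>2\<close>, and the
  property passes to pointwise limits. It therefore holds for the values of \<open>g\<close>, for its
  derivatives in the interior of D (limits of difference quotients), and for the derivatives on the
  closure of the interior (limits of those). Hence the pointwise continuity and differentiability
  of the paths carry over to v, whose Jacobian is \<open>E (\<xi> Dg(x))\<close>, and linear conditions on the
  Jacobian persist. Off the closure of the interior of D the Jacobian is unconstrained, and
  Dugundji's theorem extends it with values in the kernel of the linear condition.
\<close>

section \<open>Linear spaces of random variables with a fourth-moment bound\<close>

text \<open>The constant 3 is the fourth moment of a centred Gaussian divided by its squared
  variance. Integrability is required separately because a non-integrable function has integral 0 by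
  convention and would satisfy the inequality trivially.\<close>

definition hypercontractive_space :: "'a measure \<Rightarrow> ('a \<Rightarrow> real) set \<Rightarrow> bool"
  where "hypercontractive_space M H \<longleftrightarrow>
    (\<lambda>\<omega>. 0) \<in> H \<and>
    (\<forall>Y\<in>H. \<forall>Z\<in>H. \<forall>a. (\<lambda>\<omega>. Y \<omega> + a * Z \<omega>) \<in> H) \<and>
    (\<forall>Y\<in>H. Y \<in> borel_measurable M \<and> integrable M (\<lambda>\<omega>. Y \<omega> ^ 4) \<and>
      (\<integral>\<omega>. Y \<omega> ^ 4 \<partial>M) \<le> 3 * (\<integral>\<omega>. (Y \<omega>)\<^sup>2 \<partial>M)\<^sup>2)"

text \<open>Convergence at every point of \<open>space M\<close>, rather than almost everywhere,
  makes the limits measurable without completeness of \<open>M\<close>.\<close>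

definition limit_closure :: "'a measure \<Rightarrow> ('a \<Rightarrow> real) set \<Rightarrow> ('a \<Rightarrow> real) set"
  where "limit_closure M H =
    {Y. \<exists>Z. (\<forall>n. Z n \<in> H) \<and> (\<forall>\<omega>\<in>space M. (\<lambda>n. Z n \<omega>) \<longlonglongrightarrow> Y \<omega>)}"

lemma limit_closureI:
  assumes "\<And>n. Z n \<in> H" "\<And>\<omega>. \<omega> \<in> space M \<Longrightarrow> (\<lambda>n. Z n \<omega>) \<longlonglongrightarrow> Y \<omega>"
  shows "Y \<in> limit_closure M H"
  using assms by (auto simp: limit_closure_def)

lemma subset_limit_closure: "H \<subseteq> limit_closure M H"
  by (auto intro!: limit_closureI[where Z="\<lambda>_. _"])

lemma hypercontractive_lincomb:
  assumes "hypercontractive_space M H" "Y \<in> H" "Z \<in> H"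
  shows "(\<lambda>\<omega>. Y \<omega> + a * Z \<omega>) \<in> H"
  using assms unfolding hypercontractive_space_def by blast

lemma hypercontractive_diff:
  assumes "hypercontractive_space M H" "Y \<in> H" "Z \<in> H"
  shows "(\<lambda>\<omega>. Y \<omega> - Z \<omega>) \<in> H"
  using hypercontractive_lincomb[OF assms, of "-1"] by simp

lemma hypercontractive_sum:
  assumes H: "hypercontractive_space M H" and "\<And>i. i \<in> I \<Longrightarrow> Y i \<in> H"
  shows "(\<lambda>\<omega>. \<Sum>i\<in>I. a i * Y i \<omega>) \<in> H"
  using assms(2)
proof (induction I rule: infinite_finite_induct)
  case (insert i I)
  then have "(\<lambda>\<omega>. (\<Sum>i\<in>I. a i * Y i \<omega>) + a i * Y i \<omega>) \<in> H"
    by (intro hypercontractive_lincomb[OF H]) auto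
  then show ?case
    using insert by (simp add: add.commute)
qed (use H in \<open>auto simp: hypercontractive_space_def\<close>)

lemma hypercontractive_measurable:
  assumes "hypercontractive_space M H" "Y \<in> H"
  shows "Y \<in> borel_measurable M"
  using assms unfolding hypercontractive_space_def by blast

section \<open>Fatou and Cauchy-Schwarz for real integrals\<close>

text \<open>Fatou's lemma for the extended nonnegative integrals, translated back to real ones. It
  is used to obtain both the integrability of a limit and a bound on its moments.\<close>

lemma Fatou_bounded_integral:
  fixes f :: "'a \<Rightarrow> real"
  assumes lim: "\<And>\<omega>. \<omega> \<in> space M \<Longrightarrow> (\<lambda>n. F n \<omega>) \<longlonglongrightarrow> f \<omega>"
    and int: "\<And>n. integrable M (F n)" and nonneg: "\<And>n \<omega>. 0 \<le> F n \<omega>"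
    and bound: "eventually (\<lambda>n. (\<integral>\<omega>. F n \<omega> \<partial>M) \<le> C) sequentially"
  shows "integrable M f" "(\<integral>\<omega>. f \<omega> \<partial>M) \<le> C"
proof -
  have [measurable]: "F n \<in> borel_measurable M" for n
    using int by simp
  have f[measurable]: "f \<in> borel_measurable M"
    by (rule borel_measurable_LIMSEQ_real[OF lim]) auto
  have f_nonneg: "0 \<le> f \<omega>" if "\<omega> \<in> space M" for \<omega>
    using lim[OF that] nonneg by (meson LIMSEQ_le_const)
  \<comment> \<open>\<open>ennreal\<close> sends negative reals to 0, so the return from
    \<open>ennreal C\<close> to a real bound needs \<open>0 \<le> C\<close>; one index at which the
    bound holds supplies it.\<close>
  obtain n where "(\<integral>\<omega>. F n \<omega> \<partial>M) \<le> C"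
    using bound by (auto simp: eventually_sequentially)
  then have C: "0 \<le> C"
    using Bochner_Integration.integral_nonneg[of M "F n"] nonneg by fastforce
  have "(\<integral>\<^sup>+\<omega>. f \<omega> \<partial>M) = (\<integral>\<^sup>+\<omega>. liminf (\<lambda>n. ennreal (F n \<omega>)) \<partial>M)"
    by (intro nn_integral_cong lim_imp_Liminf[symmetric] tendsto_ennrealI lim) auto
  also have "\<dots> \<le> liminf (\<lambda>n. \<integral>\<^sup>+\<omega>. F n \<omega> \<partial>M)"
    by (rule nn_integral_liminf) auto
  also have "\<dots> \<le> ennreal C"
  proof (rule order_trans[OF Liminf_mono[of _ "\<lambda>_. ennreal C"]])
    show "\<forall>\<^sub>F n in sequentially. (\<integral>\<^sup>+\<omega>. F n \<omega> \<partial>M) \<le> ennreal C"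
      using bound
      by eventually_elim (simp add: nn_integral_eq_integral[OF int] nonneg ennreal_leI)
  qed (simp add: Liminf_const)
  finally have le: "(\<integral>\<^sup>+\<omega>. f \<omega> \<partial>M) \<le> ennreal C" .
  show "integrable M f"
    using le f_nonneg by (intro integrableI_nonneg) (auto intro: le_less_trans)
  then show "(\<integral>\<omega>. f \<omega> \<partial>M) \<le> C"
    using le C f_nonneg by (subst (asm) nn_integral_eq_integral) auto
qed

lemma integrable_mult_of_squares:
  fixes f g :: "'a \<Rightarrow> real"
  assumes [measurable]: "f \<in> borel_measurable M" "g \<in> borel_measurable M"
    and "integrable M (\<lambda>\<omega>. (f \<omega>)\<^sup>2)" "integrable M (\<lambda>\<omega>. (g \<omega>)\<^sup>2)"
  shows "integrable M (\<lambda>\<omega>. f \<omega> * g \<omega>)"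
proof (rule Bochner_Integration.integrable_bound)
  show "integrable M (\<lambda>\<omega>. (f \<omega>)\<^sup>2 + (g \<omega>)\<^sup>2)"
    using assms by simp
  have "\<bar>a * b\<bar> \<le> a\<^sup>2 + b\<^sup>2" for a b :: real
    using sum_squares_bound[of "\<bar>a\<bar>" "\<bar>b\<bar>"] abs_ge_zero[of "a * b"]
    unfolding power2_abs abs_mult by linarith
  then show "AE \<omega> in M. norm (f \<omega> * g \<omega>) \<le> norm ((f \<omega>)\<^sup>2 + (g \<omega>)\<^sup>2)"
    by simp
qed simp

text \<open>Expanding the square of \<open>a * f - b * g\<close> gives a nonnegative quadratic form
  in \<open>a\<close> and \<open>b\<close>. Evaluating it at \<open>(B, C)\<close> and
  \<open>(C, A)\<close> settles the case where \<open>A\<close> or \<open>B\<close> is positive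
  without any division; if both vanish, the point \<open>(1, C)\<close> forces
  \<open>C = 0\<close>.\<close>

lemma Cauchy_Schwarz_integral:
  fixes f g :: "'a \<Rightarrow> real"
  assumes "f \<in> borel_measurable M" "g \<in> borel_measurable M"
    and f: "integrable M (\<lambda>\<omega>. (f \<omega>)\<^sup>2)" and g: "integrable M (\<lambda>\<omega>. (g \<omega>)\<^sup>2)"
  shows "(\<integral>\<omega>. f \<omega> * g \<omega> \<partial>M)\<^sup>2 \<le> (\<integral>\<omega>. (f \<omega>)\<^sup>2 \<partial>M) * (\<integral>\<omega>. (g \<omega>)\<^sup>2 \<partial>M)"
proof -
  define A B C where "A = (\<integral>\<omega>. (f \<omega>)\<^sup>2 \<partial>M)" and "B = (\<integral>\<omega>. (g \<omega>)\<^sup>2 \<partial>M)"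
    and "C = (\<integral>\<omega>. f \<omega> * g \<omega> \<partial>M)"
  have fg: "integrable M (\<lambda>\<omega>. f \<omega> * g \<omega>)"
    by (rule integrable_mult_of_squares) fact+
  have quad: "0 \<le> a\<^sup>2 * A - 2 * a * b * C + b\<^sup>2 * B" for a b
  proof -
    have "0 \<le> (\<integral>\<omega>. (a * f \<omega> - b * g \<omega>)\<^sup>2 \<partial>M)"
      by simp
    also have "\<dots> = (\<integral>\<omega>. a\<^sup>2 * (f \<omega>)\<^sup>2 - 2 * a * b * (f \<omega> * g \<omega>) + b\<^sup>2 * (g \<omega>)\<^sup>2 \<partial>M)"
      by (intro Bochner_Integration.integral_cong) (auto simp: power2_eq_square algebra_simps)
    also have "\<dots> = a\<^sup>2 * A - 2 * a * b * C + b\<^sup>2 * B"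
      using f g fg by (simp add: A_def B_def C_def)
    finally show ?thesis .
  qed
  have "0 \<le> A" "0 \<le> B"
    by (auto simp: A_def B_def)
  moreover have "0 \<le> B * (A * B - C\<^sup>2)"
    using quad[of B C] by (simp add: power2_eq_square algebra_simps)
  moreover have "0 \<le> A * (A * B - C\<^sup>2)"
    using quad[of C A] by (simp add: power2_eq_square algebra_simps)
  moreover have "C = 0" if "A = 0" "B = 0"
    using quad[of 1 C] that zero_le_power2[of C] by (auto simp: power2_eq_square mult_le_0_iff)
  ultimately have "C\<^sup>2 \<le> A * B"
    by (cases "A = 0"; cases "B = 0") (auto simp: zero_le_mult_iff mult_le_0_iff)
  then show ?thesis
    by (simp add: A_def B_def C_def)
qed

section \<open>Pointwise limits and convergence in L2\<close>

context prob_space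
begin

text \<open>Finiteness of the measure enters here: the constant in the dominating function
  \<open>1 + Y \<omega> ^ 4\<close> is integrable.\<close>

lemma hypercontractive_integrable_square:
  assumes "hypercontractive_space M H" "Y \<in> H"
  shows "integrable M (\<lambda>\<omega>. (Y \<omega>)\<^sup>2)"
proof (rule Bochner_Integration.integrable_bound)
  show "integrable M (\<lambda>\<omega>. 1 + Y \<omega> ^ 4)"
    using assms unfolding hypercontractive_space_def by auto
  show "(\<lambda>\<omega>. (Y \<omega>)\<^sup>2) \<in> borel_measurable M"
    using hypercontractive_measurable[OF assms] by simp
  have "y\<^sup>2 \<le> 1 + y ^ 4" for y :: real
  proof -
    have "0 \<le> (y\<^sup>2 - 1/2)\<^sup>2"
      by simp
    then show ?thesis
      by (simp add: power2_diff power_divide)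
  qed
  then show "AE \<omega> in M. norm ((Y \<omega>)\<^sup>2) \<le> norm (1 + Y \<omega> ^ 4)"
    by simp
qed

text \<open>
  A Paley--Zygmund argument: \<open>y\<^sup>2 - y\<^sup>4 / (4 s) \<le> min (y\<^sup>2) s\<close>, and for \<open>s = E Y\<^sup>2\<close> the left-hand side
  has expectation at least \<open>s / 4\<close>. Hence \<open>E Y\<^sup>2\<close> is controlled by a truncated moment.
\<close>

lemma hypercontractive_truncation:
  assumes H: "hypercontractive_space M H" "Y \<in> H"
  shows "min 1 (\<integral>\<omega>. (Y \<omega>)\<^sup>2 \<partial>M) \<le> 4 * (\<integral>\<omega>. min ((Y \<omega>)\<^sup>2) 1 \<partial>M)"
proof -
  define s where "s = (\<integral>\<omega>. (Y \<omega>)\<^sup>2 \<partial>M)"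
  note [measurable] = hypercontractive_measurable[OF H]
  note int2 = hypercontractive_integrable_square[OF H]
  have int4: "integrable M (\<lambda>\<omega>. Y \<omega> ^ 4)" and le4: "(\<integral>\<omega>. Y \<omega> ^ 4 \<partial>M) \<le> 3 * s\<^sup>2"
    using H unfolding hypercontractive_space_def s_def by auto
  have int_min: "integrable M (\<lambda>\<omega>. min ((Y \<omega>)\<^sup>2) 1)"
    by (rule integrable_const_bound[where B=1]) auto
  have "0 \<le> s"
    by (simp add: s_def)
  show ?thesis
  proof (cases "s = 0")
    case True
    then show ?thesis
      by (simp add: s_def integral_nonneg)
  next
    case False
    with \<open>0 \<le> s\<close> have s: "0 < s"
      by simp
    \<comment> \<open>The truncation level moves from \<open>s\<close>, which depends on
      \<open>Y\<close>, to 1, so that one dominating function can later serve a whole sequence. For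
      \<open>s \<le> 1\<close> the minimum only grows and both factors equal \<open>s\<close>; for
      larger \<open>s\<close> the left factor is 1 and the right factor \<open>s\<close> pays for
      the lower level.\<close>
    have pointwise: "min 1 s * (y\<^sup>2 - y ^ 4 / (4 * s)) \<le> s * min (y\<^sup>2) 1" for y :: real
    proof -
      have "0 \<le> (y\<^sup>2 - 2 * s)\<^sup>2"
        by simp
      then have "4 * s * y\<^sup>2 \<le> y ^ 4 + 4 * s * s"
        by (simp add: power2_diff power2_eq_square[of s] algebra_simps)
      then have "y\<^sup>2 - y ^ 4 / (4 * s) \<le> s"
        using s by (simp add: field_simps)
      moreover have "y\<^sup>2 - y ^ 4 / (4 * s) \<le> y\<^sup>2"
        using s by simp
      ultimately have *: "y\<^sup>2 - y ^ 4 / (4 * s) \<le> min (y\<^sup>2) s"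
        by simp
      show ?thesis
      proof (cases "s \<le> 1")
        case True
        have "s * (y\<^sup>2 - y ^ 4 / (4 * s)) \<le> s * min (y\<^sup>2) 1"
          using s True * by (intro mult_left_mono) auto
        then show ?thesis
          using True by (simp add: min_def)
      next
        case False
        have "min (y\<^sup>2) s \<le> s * min (y\<^sup>2) 1"
          using False mult_right_mono[of 1 s "y\<^sup>2"] by (auto simp: min_def)
        then show ?thesis
          using False * by (simp add: min_def split: if_splits)
      qed
    qed
    have "min 1 s * (s / 4) \<le> min 1 s * (s - (\<integral>\<omega>. Y \<omega> ^ 4 \<partial>M) / (4 * s))"
      using s le4 by (intro mult_left_mono) (auto simp: field_simps power2_eq_square)
    also have "\<dots> = (\<integral>\<omega>. min 1 s * ((Y \<omega>)\<^sup>2 - Y \<omega> ^ 4 / (4 * s)) \<partial>M)"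
      using int2 int4 by (simp add: s_def)
    also have "\<dots> \<le> (\<integral>\<omega>. s * min ((Y \<omega>)\<^sup>2) 1 \<partial>M)"
      using int2 int4 int_min pointwise by (intro integral_mono) auto
    also have "\<dots> = s * (\<integral>\<omega>. min ((Y \<omega>)\<^sup>2) 1 \<partial>M)"
      by simp
    finally have "s * (min 1 s) \<le> s * (4 * (\<integral>\<omega>. min ((Y \<omega>)\<^sup>2) 1 \<partial>M))"
      by simp
    then show ?thesis
      using s by (simp add: s_def)
  qed
qed

text \<open>The truncations at 1 have expectations tending to 0 by dominated convergence, and
  \<open>hypercontractive_truncation\<close> transfers this to \<open>min 1\<close> of the second
  moments. Once this minimum is below 1, it is the second moment itself.\<close>

lemma hypercontractive_L2_tendsto_zero:
  assumes H: "hypercontractive_space M H" and Y: "\<And>n. Y n \<in> H"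
    and lim: "\<And>\<omega>. \<omega> \<in> space M \<Longrightarrow> (\<lambda>n. Y n \<omega>) \<longlonglongrightarrow> 0"
  shows "(\<lambda>n. \<integral>\<omega>. (Y n \<omega>)\<^sup>2 \<partial>M) \<longlonglongrightarrow> 0"
proof -
  note [measurable] = hypercontractive_measurable[OF H Y]
  have "(\<lambda>n. \<integral>\<omega>. min ((Y n \<omega>)\<^sup>2) 1 \<partial>M) \<longlonglongrightarrow> (\<integral>\<omega>. 0 \<partial>M)"
  proof (rule integral_dominated_convergence[where w="\<lambda>_. 1"])
    show "AE \<omega> in M. (\<lambda>n. min ((Y n \<omega>)\<^sup>2) 1) \<longlonglongrightarrow> 0"
    proof (rule AE_I2)
      fix \<omega> assume "\<omega> \<in> space M"
      from tendsto_min[OF tendsto_power[OF lim[OF this], of 2] tendsto_const[of 1]]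
      show "(\<lambda>n. min ((Y n \<omega>)\<^sup>2) 1) \<longlonglongrightarrow> 0"
        by simp
    qed
  qed auto
  then have "(\<lambda>n. 4 * (\<integral>\<omega>. min ((Y n \<omega>)\<^sup>2) 1 \<partial>M)) \<longlonglongrightarrow> 0"
    by (auto intro: tendsto_mult_right_zero)
  then have lim_min: "(\<lambda>n. min 1 (\<integral>\<omega>. (Y n \<omega>)\<^sup>2 \<partial>M)) \<longlonglongrightarrow> 0"
    by (rule tendsto_sandwich[OF _ _ tendsto_const, rotated 2])
      (auto intro!: always_eventually hypercontractive_truncation[OF H Y])
  then have "\<forall>\<^sub>F n in sequentially. min 1 (\<integral>\<omega>. (Y n \<omega>)\<^sup>2 \<partial>M) < 1"
    by (rule order_tendstoD) simp
  then have "\<forall>\<^sub>F n in sequentially. min 1 (\<integral>\<omega>. (Y n \<omega>)\<^sup>2 \<partial>M) = (\<integral>\<omega>. (Y n \<omega>)\<^sup>2 \<partial>M)"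
    by eventually_elim (auto simp: min_def split: if_splits)
  from tendsto_cong[THEN iffD1, OF this lim_min] show ?thesis .
qed

text \<open>The limit \<open>Y\<close> may lie outside \<open>H\<close>, so the result on null
  sequences is applied to differences of members of the sequence. This gives the Cauchy property in
  L2, and Fatou carries it to \<open>Y\<close>.\<close>

lemma hypercontractive_L2_limit:
  assumes H: "hypercontractive_space M H" and Z: "\<And>n. Z n \<in> H"
    and lim: "\<And>\<omega>. \<omega> \<in> space M \<Longrightarrow> (\<lambda>n. Z n \<omega>) \<longlonglongrightarrow> Y \<omega>"
  shows "integrable M (\<lambda>\<omega>. (Y \<omega>)\<^sup>2)"
    and "(\<lambda>n. \<integral>\<omega>. (Z n \<omega> - Y \<omega>)\<^sup>2 \<partial>M) \<longlonglongrightarrow> 0"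
proof -
  define d where "d m n = (\<integral>\<omega>. (Z m \<omega> - Z n \<omega>)\<^sup>2 \<partial>M)" for m n
  have Cauchy: "\<exists>N. \<forall>m\<ge>N. \<forall>n\<ge>N. d m n \<le> e" if "e > 0" for e
  \<comment> \<open>If the Cauchy property fails, there are indices \<open>a N\<close> and
    \<open>b N\<close>, both at least \<open>N\<close>, with squared L2 distance above
    \<open>e\<close>. Both tend to infinity, so the differences form a pointwise null sequence in
    \<open>H\<close>, whose second moments must tend to 0.\<close>
  proof (rule ccontr)
    assume "\<not> ?thesis"
    then have "\<forall>N. \<exists>m n. N \<le> m \<and> N \<le> n \<and> e < d m n"
      by (meson not_le)
    then obtain a b where ab: "\<And>N. N \<le> a N" "\<And>N. N \<le> b N" "\<And>N. e < d (a N) (b N)"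
      by metis
    then have "filterlim a at_top sequentially" "filterlim b at_top sequentially"
      by (auto intro: filterlim_at_top_mono[OF filterlim_ident])
    then have "(\<lambda>N. Z (a N) \<omega> - Z (b N) \<omega>) \<longlonglongrightarrow> 0" if "\<omega> \<in> space M" for \<omega>
      using tendsto_diff[OF filterlim_compose[OF lim[OF that]] filterlim_compose[OF lim[OF that]]]
      by fastforce
    then have "(\<lambda>N. d (a N) (b N)) \<longlonglongrightarrow> 0"
      unfolding d_def
      by (intro hypercontractive_L2_tendsto_zero[OF H] hypercontractive_diff[OF H] Z)
    from order_tendstoD(2)[OF this \<open>e > 0\<close>] obtain N where "d (a N) (b N) < e"
      by (auto simp: eventually_sequentially)
    with ab(3)[of N] show False
      by simp
  qed
  \<comment> \<open>Here \<open>m\<close> is fixed and Fatou acts along \<open>n\<close>.\<close>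
  have diff: "integrable M (\<lambda>\<omega>. (Z m \<omega> - Y \<omega>)\<^sup>2) \<and> (\<integral>\<omega>. (Z m \<omega> - Y \<omega>)\<^sup>2 \<partial>M) \<le> e"
    if "\<And>n. n \<ge> N \<Longrightarrow> d m n \<le> e" for m N e
  proof -
    have "(\<lambda>n. (Z m \<omega> - Z n \<omega>)\<^sup>2) \<longlonglongrightarrow> (Z m \<omega> - Y \<omega>)\<^sup>2" if "\<omega> \<in> space M" for \<omega>
      by (intro tendsto_intros lim that)
    moreover have "integrable M (\<lambda>\<omega>. (Z m \<omega> - Z n \<omega>)\<^sup>2)" for n
      by (intro hypercontractive_integrable_square[OF H] hypercontractive_diff[OF H] Z)
    moreover have "\<forall>\<^sub>F n in sequentially. (\<integral>\<omega>. (Z m \<omega> - Z n \<omega>)\<^sup>2 \<partial>M) \<le> e"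
      using that by (auto simp: d_def eventually_sequentially)
    ultimately show ?thesis
      using Fatou_bounded_integral[of M "\<lambda>n \<omega>. (Z m \<omega> - Z n \<omega>)\<^sup>2" "\<lambda>\<omega>. (Z m \<omega> - Y \<omega>)\<^sup>2" e]
      by auto
  qed
  show "(\<lambda>n. \<integral>\<omega>. (Z n \<omega> - Y \<omega>)\<^sup>2 \<partial>M) \<longlonglongrightarrow> 0"
  proof (rule LIMSEQ_I)
    fix r :: real assume "r > 0"
    then obtain N where "\<And>m n. m \<ge> N \<Longrightarrow> n \<ge> N \<Longrightarrow> d m n \<le> r / 2"
      using Cauchy[of "r / 2"] by auto
    with diff \<open>r > 0\<close> show "\<exists>N. \<forall>m\<ge>N. norm ((\<integral>\<omega>. (Z m \<omega> - Y \<omega>)\<^sup>2 \<partial>M) - 0) < r"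
      by (intro exI[of _ N]) fastforce
  qed
  obtain N where "\<And>n. n \<ge> N \<Longrightarrow> d N n \<le> 1"
    using Cauchy[of 1] by auto
  then have int: "integrable M (\<lambda>\<omega>. (Z N \<omega> - Y \<omega>)\<^sup>2)"
    using diff by blast
  have [measurable]: "Z n \<in> borel_measurable M" for n
    by (rule hypercontractive_measurable[OF H Z])
  have [measurable]: "Y \<in> borel_measurable M"
    by (rule borel_measurable_LIMSEQ_real[OF lim]) auto
  show "integrable M (\<lambda>\<omega>. (Y \<omega>)\<^sup>2)"
  proof (rule Bochner_Integration.integrable_bound)
    show "integrable M (\<lambda>\<omega>. 2 * (Z N \<omega>)\<^sup>2 + 2 * (Z N \<omega> - Y \<omega>)\<^sup>2)"
      using int hypercontractive_integrable_square[OF H Z] by simp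
    have "y\<^sup>2 \<le> 2 * z\<^sup>2 + 2 * (z - y)\<^sup>2" for y z :: real
      using zero_le_power2[of "2 * z - y"] by (simp add: power2_eq_square algebra_simps)
    then show "AE \<omega> in M. norm ((Y \<omega>)\<^sup>2) \<le> norm (2 * (Z N \<omega>)\<^sup>2 + 2 * (Z N \<omega> - Y \<omega>)\<^sup>2)"
      by simp
  qed simp
qed

text \<open>Fatou suffices for the fourth moments, which only need an upper bound. The second
  moments stand on the right-hand side of the inequality, so for them genuine convergence is shown,
  via convergence in L2.\<close>

lemma hypercontractive_limit_closure:
  assumes H: "hypercontractive_space M H"
  shows "hypercontractive_space M (limit_closure M H)"
  unfolding hypercontractive_space_def
proof (intro conjI ballI allI)
  show "(\<lambda>\<omega>. 0) \<in> limit_closure M H"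
    using subset_limit_closure H unfolding hypercontractive_space_def by blast
next
  fix Y Z and a :: real
  assume "Y \<in> limit_closure M H" "Z \<in> limit_closure M H"
  then obtain F G where FG: "\<And>n. F n \<in> H" "\<And>n. G n \<in> H"
    "\<And>\<omega>. \<omega> \<in> space M \<Longrightarrow> (\<lambda>n. F n \<omega>) \<longlonglongrightarrow> Y \<omega>"
    "\<And>\<omega>. \<omega> \<in> space M \<Longrightarrow> (\<lambda>n. G n \<omega>) \<longlonglongrightarrow> Z \<omega>"
    unfolding limit_closure_def by blast
  show "(\<lambda>\<omega>. Y \<omega> + a * Z \<omega>) \<in> limit_closure M H"
    by (rule limit_closureI[where Z="\<lambda>n \<omega>. F n \<omega> + a * G n \<omega>"])
      (auto intro!: tendsto_intros hypercontractive_lincomb[OF H] FG)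
next
  fix Y assume "Y \<in> limit_closure M H"
  then obtain Z where Z: "\<And>n. Z n \<in> H"
    and lim: "\<And>\<omega>. \<omega> \<in> space M \<Longrightarrow> (\<lambda>n. Z n \<omega>) \<longlonglongrightarrow> Y \<omega>"
    unfolding limit_closure_def by blast
  have Z_meas[measurable]: "Z n \<in> borel_measurable M" for n
    by (rule hypercontractive_measurable[OF H Z])
  show Y_meas[measurable]: "Y \<in> borel_measurable M"
    by (rule borel_measurable_LIMSEQ_real[OF lim]) auto
  note Y2 = hypercontractive_L2_limit(1)[OF H Z lim]
  note L2 = hypercontractive_L2_limit(2)[OF H Z lim]
  define s where "s = (\<integral>\<omega>. (Y \<omega>)\<^sup>2 \<partial>M)"
  have Z4: "integrable M (\<lambda>\<omega>. Z n \<omega> ^ 4)"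
    and Z4_le: "(\<integral>\<omega>. Z n \<omega> ^ 4 \<partial>M) \<le> 3 * (\<integral>\<omega>. (Z n \<omega>)\<^sup>2 \<partial>M)\<^sup>2" for n
    using H Z unfolding hypercontractive_space_def by auto
  \<comment> \<open>Writing \<open>Z n\<close> as \<open>(Z n - Y) + Y\<close> leaves the L2
    distance and a cross term, which Cauchy-Schwarz bounds by the same distance.\<close>
  have "(\<integral>\<omega>. (Z n \<omega>)\<^sup>2 \<partial>M) - s =
      (\<integral>\<omega>. (Z n \<omega> - Y \<omega>)\<^sup>2 \<partial>M) + 2 * (\<integral>\<omega>. (Z n \<omega> - Y \<omega>) * Y \<omega> \<partial>M)"
    and "\<bar>\<integral>\<omega>. (Z n \<omega> - Y \<omega>) * Y \<omega> \<partial>M\<bar> \<le> sqrt ((\<integral>\<omega>. (Z n \<omega> - Y \<omega>)\<^sup>2 \<partial>M) * s)" for n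
  proof -
    note Z2 = hypercontractive_integrable_square[OF H Z[of n]]
    have ZY: "integrable M (\<lambda>\<omega>. Z n \<omega> * Y \<omega>)"
      by (rule integrable_mult_of_squares[OF _ _ Z2 Y2]) auto
    have D2: "integrable M (\<lambda>\<omega>. (Z n \<omega> - Y \<omega>)\<^sup>2)"
      using Z2 Y2 ZY by (simp add: power2_diff mult.assoc)
    show "\<bar>\<integral>\<omega>. (Z n \<omega> - Y \<omega>) * Y \<omega> \<partial>M\<bar> \<le> sqrt ((\<integral>\<omega>. (Z n \<omega> - Y \<omega>)\<^sup>2 \<partial>M) * s)"
      using Cauchy_Schwarz_integral[OF _ _ D2 Y2] unfolding s_def
      by (intro real_le_rsqrt) auto
    show "(\<integral>\<omega>. (Z n \<omega>)\<^sup>2 \<partial>M) - s =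
      (\<integral>\<omega>. (Z n \<omega> - Y \<omega>)\<^sup>2 \<partial>M) + 2 * (\<integral>\<omega>. (Z n \<omega> - Y \<omega>) * Y \<omega> \<partial>M)"
      using Z2 Y2 ZY unfolding s_def
      by (simp add: power2_diff left_diff_distrib mult.assoc power2_eq_square[of "Y _", symmetric])
  qed
  note eq = this(1) and cs = this(2)
  have "(\<lambda>n. \<integral>\<omega>. (Z n \<omega> - Y \<omega>) * Y \<omega> \<partial>M) \<longlonglongrightarrow> 0"
  proof (rule Lim_null_comparison)
    show "\<forall>\<^sub>F n in sequentially. norm (\<integral>\<omega>. (Z n \<omega> - Y \<omega>) * Y \<omega> \<partial>M)
        \<le> sqrt ((\<integral>\<omega>. (Z n \<omega> - Y \<omega>)\<^sup>2 \<partial>M) * s)"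
      using cs by simp
    show "(\<lambda>n. sqrt ((\<integral>\<omega>. (Z n \<omega> - Y \<omega>)\<^sup>2 \<partial>M) * s)) \<longlonglongrightarrow> 0"
      using tendsto_real_sqrt[OF tendsto_mult[OF L2 tendsto_const[of s]]] by simp
  qed
  from tendsto_add[OF L2 tendsto_mult[OF tendsto_const[of 2] this]]
  have "(\<lambda>n. \<integral>\<omega>. (Z n \<omega>)\<^sup>2 \<partial>M) \<longlonglongrightarrow> s"
    unfolding eq[symmetric] by (simp add: LIM_zero_iff)
  then have bound: "(\<lambda>n. 3 * (\<integral>\<omega>. (Z n \<omega>)\<^sup>2 \<partial>M)\<^sup>2) \<longlonglongrightarrow> 3 * s\<^sup>2"
    by (intro tendsto_intros)
  \<comment> \<open>The bounds \<open>3 * (\<integral>\<omega>. (Z n \<omega>)\<^sup>2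
    \<partial>M)\<^sup>2\<close> vary with \<open>n\<close> and are eventually below their limit
    plus \<open>e\<close>; \<open>field_le_epsilon\<close> removes \<open>e\<close> at the
    end.\<close>
  have Fatou: "integrable M (\<lambda>\<omega>. Y \<omega> ^ 4)" "(\<integral>\<omega>. Y \<omega> ^ 4 \<partial>M) \<le> 3 * s\<^sup>2 + e" if "e > 0" for e
  proof -
    have "\<forall>\<^sub>F n in sequentially. (\<integral>\<omega>. Z n \<omega> ^ 4 \<partial>M) \<le> 3 * s\<^sup>2 + e"
      using order_tendstoD(2)[OF bound, of "3 * s\<^sup>2 + e"] that
      by (auto elim!: eventually_mono intro: order_trans[OF Z4_le])
    moreover have "(\<lambda>n. Z n \<omega> ^ 4) \<longlonglongrightarrow> Y \<omega> ^ 4" if "\<omega> \<in> space M" for \<omega>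
      by (intro tendsto_intros lim that)
    ultimately show "integrable M (\<lambda>\<omega>. Y \<omega> ^ 4)" "(\<integral>\<omega>. Y \<omega> ^ 4 \<partial>M) \<le> 3 * s\<^sup>2 + e"
      using Fatou_bounded_integral[of M "\<lambda>n \<omega>. Z n \<omega> ^ 4" "\<lambda>\<omega>. Y \<omega> ^ 4"] Z4 by auto
  qed
  show "integrable M (\<lambda>\<omega>. Y \<omega> ^ 4)"
    using Fatou(1)[of 1] by simp
  show "(\<integral>\<omega>. Y \<omega> ^ 4 \<partial>M) \<le> 3 * (\<integral>\<omega>. (Y \<omega>)\<^sup>2 \<partial>M)\<^sup>2"
    using Fatou(2) unfolding s_def by (rule field_le_epsilon)
qed

end

section \<open>Fourth moments of Gaussian variables\<close>

context prob_space
begin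

text \<open>The mean may be nonzero: the fourth moment is \<open>3 * \<sigma> ^ 4 + 6 *
  \<mu>\<^sup>2 * \<sigma>\<^sup>2 + \<mu> ^ 4\<close>, which falls short of
  \<open>3 * (\<sigma>\<^sup>2 + \<mu>\<^sup>2)\<^sup>2\<close> by \<open>2 * \<mu> ^ 4\<close>. An
  almost surely constant variable has fourth moment equal to the squared second moment.\<close>

lemma gaussian_fourth_moment:
  assumes "gaussian_real M Y"
  shows "integrable M (\<lambda>\<omega>. Y \<omega> ^ 4)"
    and "(\<integral>\<omega>. Y \<omega> ^ 4 \<partial>M) \<le> 3 * (\<integral>\<omega>. (Y \<omega>)\<^sup>2 \<partial>M)\<^sup>2"
proof -
  have [measurable]: "Y \<in> borel_measurable M"
    using assms by (simp add: gaussian_real_def)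
  consider (const) \<mu> where "AE \<omega> in M. Y \<omega> = \<mu>"
    | (normal) \<mu> \<sigma> where "\<sigma> > 0" "distributed M lborel Y (\<lambda>y. ennreal (normal_density \<mu> \<sigma> y))"
    using assms by (auto simp: gaussian_real_def)
  then have "integrable M (\<lambda>\<omega>. Y \<omega> ^ 4) \<and>
    (\<integral>\<omega>. Y \<omega> ^ 4 \<partial>M) \<le> 3 * (\<integral>\<omega>. (Y \<omega>)\<^sup>2 \<partial>M)\<^sup>2"
  proof cases
    case const
    have "(\<integral>\<omega>. Y \<omega> ^ k \<partial>M) = \<mu> ^ k" for k
    proof -
      have "(\<integral>\<omega>. Y \<omega> ^ k \<partial>M) = (\<integral>\<omega>. \<mu> ^ k \<partial>M)"
        using const by (intro integral_cong_AE) auto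
      then show ?thesis
        by (simp add: prob_space)
    qed
    moreover have "integrable M (\<lambda>\<omega>. Y \<omega> ^ 4) \<longleftrightarrow> integrable M (\<lambda>\<omega>. \<mu> ^ 4)"
      using const by (intro integrable_cong_AE) auto
    moreover have "(\<mu>\<^sup>2)\<^sup>2 = \<mu> ^ 4"
      by (simp flip: power_mult)
    ultimately show ?thesis
      by simp
  next
    case normal
    let ?n = "normal_density \<mu> \<sigma>"
    have m1: "has_bochner_integral lborel (\<lambda>x. ?n x * (x - \<mu>) ^ 1) 0"
      and m3: "has_bochner_integral lborel (\<lambda>x. ?n x * (x - \<mu>) ^ 3) 0"
      using normal_moment_odd[OF normal(1), of \<mu> 0] normal_moment_odd[OF normal(1), of \<mu> 1]
      by simp_all
    have m0: "has_bochner_integral lborel (\<lambda>x. ?n x) 1"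
      and m2: "has_bochner_integral lborel (\<lambda>x. ?n x * (x - \<mu>) ^ 2) (\<sigma>\<^sup>2)"
      using normal_moment_even[OF normal(1), of \<mu> 0] normal_moment_even[OF normal(1), of \<mu> 1]
      by simp_all
    \<comment> \<open>The formula for the central moment of order \<open>2 * k\<close> at
      \<open>k = 2\<close>: 24 / (4 * 2) = 3.\<close>
    have "fact (2 * 2) / ((2 / \<sigma>\<^sup>2)\<^sup>2 * fact 2) = 3 * \<sigma> ^ 4"
      by (simp add: fact_numeral power_divide flip: power_mult)
    then have m4: "has_bochner_integral lborel (\<lambda>x. ?n x * (x - \<mu>) ^ 4) (3 * \<sigma> ^ 4)"
      using normal_moment_even[OF normal(1), of \<mu> 2] by simp
    \<comment> \<open>Binomial expansion of \<open>((x - \<mu>) + \<mu>) ^ 4\<close>, which reduces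
      the raw moment to central ones; the odd ones vanish.\<close>
    have "has_bochner_integral lborel (\<lambda>x. ?n x * (x - \<mu>) ^ 4 + 4 * \<mu> * (?n x * (x - \<mu>) ^ 3)
        + 6 * \<mu>\<^sup>2 * (?n x * (x - \<mu>) ^ 2) + 4 * \<mu> ^ 3 * (?n x * (x - \<mu>) ^ 1) + \<mu> ^ 4 * ?n x)
      (3 * \<sigma> ^ 4 + 4 * \<mu> * 0 + 6 * \<mu>\<^sup>2 * \<sigma>\<^sup>2 + 4 * \<mu> ^ 3 * 0 + \<mu> ^ 4 * 1)"
      by (intro has_bochner_integral_add has_bochner_integral_mult_right m0 m1 m2 m3 m4)
    also have "(\<lambda>x. ?n x * (x - \<mu>) ^ 4 + 4 * \<mu> * (?n x * (x - \<mu>) ^ 3)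
        + 6 * \<mu>\<^sup>2 * (?n x * (x - \<mu>) ^ 2) + 4 * \<mu> ^ 3 * (?n x * (x - \<mu>) ^ 1) + \<mu> ^ 4 * ?n x)
      = (\<lambda>x. ?n x * x ^ 4)"
      by (intro ext) algebra
    finally have x4: "has_bochner_integral lborel (\<lambda>x. ?n x * x ^ 4)
        (3 * \<sigma> ^ 4 + 6 * \<mu>\<^sup>2 * \<sigma>\<^sup>2 + \<mu> ^ 4)"
      by simp
    have "has_bochner_integral lborel (\<lambda>x. ?n x * (x - \<mu>) ^ 2 + 2 * \<mu> * (?n x * (x - \<mu>) ^ 1)
        + \<mu>\<^sup>2 * ?n x) (\<sigma>\<^sup>2 + 2 * \<mu> * 0 + \<mu>\<^sup>2 * 1)"
      by (intro has_bochner_integral_add has_bochner_integral_mult_right m0 m1 m2)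
    also have "(\<lambda>x. ?n x * (x - \<mu>) ^ 2 + 2 * \<mu> * (?n x * (x - \<mu>) ^ 1) + \<mu>\<^sup>2 * ?n x)
      = (\<lambda>x. ?n x * x\<^sup>2)"
      by (intro ext) algebra
    finally have x2: "has_bochner_integral lborel (\<lambda>x. ?n x * x\<^sup>2) (\<sigma>\<^sup>2 + \<mu>\<^sup>2)"
      by simp
    have "integrable M (\<lambda>\<omega>. Y \<omega> ^ 4)"
      using distributed_integrable[OF normal(2), of "\<lambda>x. x ^ 4"] x4
      by (simp add: has_bochner_integral_iff)
    moreover have "(\<integral>\<omega>. Y \<omega> ^ 4 \<partial>M) = 3 * \<sigma> ^ 4 + 6 * \<mu>\<^sup>2 * \<sigma>\<^sup>2 + \<mu> ^ 4"
      using distributed_integral[OF normal(2), of "\<lambda>x. x ^ 4"] x4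
      by (simp add: has_bochner_integral_iff)
    moreover have "(\<integral>\<omega>. (Y \<omega>)\<^sup>2 \<partial>M) = \<sigma>\<^sup>2 + \<mu>\<^sup>2"
      using distributed_integral[OF normal(2), of "\<lambda>x. x\<^sup>2"] x2
      by (simp add: has_bochner_integral_iff)
    moreover have "3 * (\<sigma>\<^sup>2 + \<mu>\<^sup>2)\<^sup>2 = (3 * \<sigma> ^ 4 + 6 * \<mu>\<^sup>2 * \<sigma>\<^sup>2 + \<mu> ^ 4) + 2 * \<mu> ^ 4"
      by algebra
    ultimately show ?thesis
      by simp
  qed
  then show "integrable M (\<lambda>\<omega>. Y \<omega> ^ 4)"
    and "(\<integral>\<omega>. Y \<omega> ^ 4 \<partial>M) \<le> 3 * (\<integral>\<omega>. (Y \<omega>)\<^sup>2 \<partial>M)\<^sup>2"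
    by auto
qed

end

section \<open>The linear span of the values of a Gaussian process\<close>

definition linear_functionals ::
  "(real^'n) set \<Rightarrow> ('a \<Rightarrow> real^'n \<Rightarrow> real^'n) \<Rightarrow> ('a \<Rightarrow> real) set"
  where "linear_functionals D f =
    {Y. \<exists>X c. finite X \<and> X \<subseteq> D \<and> Y = (\<lambda>\<omega>. \<Sum>x\<in>X. c x \<bullet> f \<omega> x)}"

text \<open>
  The field is only almost surely differentiable, so it will be replaced by a modification \<open>f\<close> for
  which this holds at every point of the sample space.
\<close>

lemma (in prob_space) hypercontractive_linear_functionals:
  fixes f g :: "'a \<Rightarrow> real^'n \<Rightarrow> real^'n"
  assumes g: "gaussian_process M D g" and ae: "AE \<omega> in M. f \<omega> = g \<omega>"
    and f: "\<And>x. x \<in> D \<Longrightarrow> (\<lambda>\<omega>. f \<omega> x) \<in> borel_measurable M"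
  shows "hypercontractive_space M (linear_functionals D f)"
  unfolding hypercontractive_space_def
proof (intro conjI ballI allI)
  show "(\<lambda>\<omega>. 0) \<in> linear_functionals D f"
    by (auto simp: linear_functionals_def intro!: exI[of _ "{}"])
next
  fix Y Z and a :: real
  assume "Y \<in> linear_functionals D f" "Z \<in> linear_functionals D f"
  then obtain A B c d where A: "finite A" "A \<subseteq> D" "Y = (\<lambda>\<omega>. \<Sum>x\<in>A. c x \<bullet> f \<omega> x)"
    and B: "finite B" "B \<subseteq> D" "Z = (\<lambda>\<omega>. \<Sum>x\<in>B. d x \<bullet> f \<omega> x)"
    unfolding linear_functionals_def by blast
  \<comment> \<open>Both coefficient families are extended by zero to \<open>A \<union> B\<close>,
    and \<open>a\<close> is absorbed into the second one.\<close>
  define e where "e x = (if x \<in> A then c x else 0) + (if x \<in> B then a *\<^sub>R d x else 0)" for x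
  have "Y \<omega> + a * Z \<omega> = (\<Sum>x\<in>A \<union> B. e x \<bullet> f \<omega> x)" for \<omega>
  proof -
    have "Y \<omega> = (\<Sum>x\<in>A \<union> B. (if x \<in> A then c x else 0) \<bullet> f \<omega> x)"
      unfolding A using A B by (intro sum.mono_neutral_cong_left) auto
    moreover have "a * Z \<omega> = (\<Sum>x\<in>A \<union> B. (if x \<in> B then a *\<^sub>R d x else 0) \<bullet> f \<omega> x)"
      unfolding B sum_distrib_left using A B by (intro sum.mono_neutral_cong_left) auto
    ultimately show ?thesis
      by (simp add: e_def inner_add_left sum.distrib)
  qed
  then show "(\<lambda>\<omega>. Y \<omega> + a * Z \<omega>) \<in> linear_functionals D f"
    using A B by (auto simp: linear_functionals_def intro!: exI[of _ "A \<union> B"] exI[of _ e])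
next
  fix Y assume "Y \<in> linear_functionals D f"
  then obtain X c where X: "finite X" "X \<subseteq> D" "Y = (\<lambda>\<omega>. \<Sum>x\<in>X. c x \<bullet> f \<omega> x)"
    unfolding linear_functionals_def by blast
  \<comment> \<open>Gaussianity is known for \<open>g\<close>, so the moments are estimated for the
    same combination of values of \<open>g\<close>, which agrees with \<open>Y\<close> almost
    everywhere.\<close>
  define Z where "Z = (\<lambda>\<omega>. \<Sum>x\<in>X. c x \<bullet> g \<omega> x)"
  show [measurable]: "Y \<in> borel_measurable M"
    using f X by (auto intro!: borel_measurable_sum borel_measurable_inner)
  have "gaussian_real M Z"
    using g X unfolding gaussian_process_def jointly_gaussian_def Z_def by blast
  note Z = gaussian_fourth_moment[OF this]
  have [measurable]: "Z \<in> borel_measurable M"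
    using \<open>gaussian_real M Z\<close> by (simp add: gaussian_real_def)
  have YZ: "AE \<omega> in M. Y \<omega> = Z \<omega>"
    using ae by eventually_elim (simp add: X Z_def)
  have eq: "(\<integral>\<omega>. Y \<omega> ^ k \<partial>M) = (\<integral>\<omega>. Z \<omega> ^ k \<partial>M)" for k
    using YZ by (intro integral_cong_AE) auto
  have "integrable M (\<lambda>\<omega>. Y \<omega> ^ 4) \<longleftrightarrow> integrable M (\<lambda>\<omega>. Z \<omega> ^ 4)"
    using YZ by (intro integrable_cong_AE) auto
  then show "integrable M (\<lambda>\<omega>. Y \<omega> ^ 4)"
    using Z by simp
  show "(\<integral>\<omega>. Y \<omega> ^ 4 \<partial>M) \<le> 3 * (\<integral>\<omega>. (Y \<omega>)\<^sup>2 \<partial>M)\<^sup>2"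
    unfolding eq by (rule Z)
qed

section \<open>Vector-valued variables and weighted expectations\<close>

definition vector_in :: "('a \<Rightarrow> real) set \<Rightarrow> ('a \<Rightarrow> 'b::euclidean_space) \<Rightarrow> bool"
  where "vector_in H F \<longleftrightarrow> (\<forall>c. (\<lambda>\<omega>. c \<bullet> F \<omega>) \<in> H)"

lemma vector_in_mono: "vector_in H F \<Longrightarrow> H \<subseteq> H' \<Longrightarrow> vector_in H' F"
  by (auto simp: vector_in_def)

lemma vector_in_Basis:
  fixes F :: "'a \<Rightarrow> 'b::euclidean_space"
  assumes "hypercontractive_space M H" "\<And>b. b \<in> Basis \<Longrightarrow> (\<lambda>\<omega>. F \<omega> \<bullet> b) \<in> H"
  shows "vector_in H F"
  unfolding vector_in_def
proof
  fix c :: 'b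
  have "(\<lambda>\<omega>. \<Sum>b\<in>Basis. (c \<bullet> b) * (F \<omega> \<bullet> b)) \<in> H"
    by (rule hypercontractive_sum[OF assms])
  then show "(\<lambda>\<omega>. c \<bullet> F \<omega>) \<in> H"
    by (simp only: euclidean_inner[symmetric])
qed

lemma vector_in_linear:
  fixes T :: "'b::euclidean_space \<Rightarrow> 'c::euclidean_space"
  assumes "vector_in H F" "linear T"
  shows "vector_in H (\<lambda>\<omega>. T (F \<omega>))"
  unfolding vector_in_def
proof
  fix c
  have "(\<lambda>\<omega>. adjoint T c \<bullet> F \<omega>) \<in> H"
    using assms by (simp add: vector_in_def)
  then show "(\<lambda>\<omega>. c \<bullet> T (F \<omega>)) \<in> H"
    using adjoint_works[OF assms(2)] by (simp add: inner_commute)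
qed

lemma vector_in_lincomb:
  assumes H: "hypercontractive_space M H" and "vector_in H F" "vector_in H G"
  shows "vector_in H (\<lambda>\<omega>. F \<omega> + a *\<^sub>R G \<omega>)"
  using assms by (auto simp: vector_in_def inner_add_right intro!: hypercontractive_lincomb[OF H])

lemma vector_in_limit_closure:
  assumes "\<And>n. vector_in H (F n)" "\<And>\<omega>. \<omega> \<in> space M \<Longrightarrow> (\<lambda>n. F n \<omega>) \<longlonglongrightarrow> G \<omega>"
  shows "vector_in (limit_closure M H) G"
  unfolding vector_in_def
proof
  fix c
  show "(\<lambda>\<omega>. c \<bullet> G \<omega>) \<in> limit_closure M H"
    by (rule limit_closureI[where Z="\<lambda>n \<omega>. c \<bullet> F n \<omega>"])
      (use assms in \<open>auto simp: vector_in_def intro!: tendsto_intros\<close>)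
qed

context prob_space
begin

lemma vector_in_integrable:
  fixes F :: "'a \<Rightarrow> 'b::euclidean_space"
  assumes H: "hypercontractive_space M H" and F: "vector_in H F"
    and \<xi>: "\<xi> \<in> borel_measurable M" "integrable M (\<lambda>\<omega>. (\<xi> \<omega>)\<^sup>2)"
  shows "integrable M (\<lambda>\<omega>. \<xi> \<omega> *\<^sub>R F \<omega>)"
proof -
  have "integrable M (\<lambda>\<omega>. \<Sum>b\<in>Basis. (\<xi> \<omega> * (b \<bullet> F \<omega>)) *\<^sub>R b)"
  proof (intro Bochner_Integration.integrable_sum integrable_scaleR_left)
    fix b :: 'b
    have "(\<lambda>\<omega>. b \<bullet> F \<omega>) \<in> H"
      using F by (simp add: vector_in_def)
    then show "integrable M (\<lambda>\<omega>. \<xi> \<omega> * (b \<bullet> F \<omega>))"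
      by (intro integrable_mult_of_squares \<xi> hypercontractive_measurable[OF H]
          hypercontractive_integrable_square[OF H])
  qed
  also have "(\<lambda>\<omega>. \<Sum>b\<in>Basis. (\<xi> \<omega> * (b \<bullet> F \<omega>)) *\<^sub>R b) = (\<lambda>\<omega>. \<xi> \<omega> *\<^sub>R F \<omega>)"
    by (simp add: inner_commute[of _ "F _"] euclidean_representation
        flip: scaleR_scaleR scaleR_sum_right)
  finally show ?thesis .
qed

text \<open>The interchange of limit and expectation behind every later continuity and
  differentiability claim. In each coordinate, Cauchy-Schwarz against the fixed weight
  \<open>\<xi>\<close> reduces it to convergence in L2, which follows from pointwise convergence
  because the differences \<open>F n - G\<close> have their components in \<open>H\<close>.\<close>

lemma tendsto_integral_vector_in:
  assumes H: "hypercontractive_space M H" and F: "\<And>n. vector_in H (F n)" and G: "vector_in H G"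
    and lim: "\<And>\<omega>. \<omega> \<in> space M \<Longrightarrow> (\<lambda>n. F n \<omega>) \<longlonglongrightarrow> G \<omega>"
    and \<xi>: "\<xi> \<in> borel_measurable M" "integrable M (\<lambda>\<omega>. (\<xi> \<omega>)\<^sup>2)"
  shows "(\<lambda>n. \<integral>\<omega>. \<xi> \<omega> *\<^sub>R F n \<omega> \<partial>M) \<longlonglongrightarrow> (\<integral>\<omega>. \<xi> \<omega> *\<^sub>R G \<omega> \<partial>M)"
proof -
  have "(\<lambda>n. ((\<integral>\<omega>. \<xi> \<omega> *\<^sub>R F n \<omega> \<partial>M) - (\<integral>\<omega>. \<xi> \<omega> *\<^sub>R G \<omega> \<partial>M)) \<bullet> b) \<longlonglongrightarrow> 0" for b
  proof -
    define Y where "Y n \<omega> = b \<bullet> F n \<omega> - b \<bullet> G \<omega>" for n \<omega>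
    have Y: "Y n \<in> H" for n
      using hypercontractive_diff[OF H] F G by (simp add: vector_in_def Y_def[abs_def])
    have "((\<integral>\<omega>. \<xi> \<omega> *\<^sub>R F n \<omega> \<partial>M) - (\<integral>\<omega>. \<xi> \<omega> *\<^sub>R G \<omega> \<partial>M)) \<bullet> b = (\<integral>\<omega>. \<xi> \<omega> * Y n \<omega> \<partial>M)" for n
    proof -
      have FG: "integrable M (\<lambda>\<omega>. \<xi> \<omega> *\<^sub>R F n \<omega>)" "integrable M (\<lambda>\<omega>. \<xi> \<omega> *\<^sub>R G \<omega>)"
        by (intro vector_in_integrable[OF H] F G \<xi>)+
      then have "((\<integral>\<omega>. \<xi> \<omega> *\<^sub>R F n \<omega> \<partial>M) - (\<integral>\<omega>. \<xi> \<omega> *\<^sub>R G \<omega> \<partial>M)) \<bullet> b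
        = (\<integral>\<omega>. \<xi> \<omega> *\<^sub>R F n \<omega> - \<xi> \<omega> *\<^sub>R G \<omega> \<partial>M) \<bullet> b"
        by simp
      also have "\<dots> = (\<integral>\<omega>. (\<xi> \<omega> *\<^sub>R F n \<omega> - \<xi> \<omega> *\<^sub>R G \<omega>) \<bullet> b \<partial>M)"
        using FG by (intro integral_inner_left[symmetric]) auto
      also have "\<dots> = (\<integral>\<omega>. \<xi> \<omega> * Y n \<omega> \<partial>M)"
        by (simp add: Y_def inner_diff_left inner_commute[of b] right_diff_distrib)
      finally show ?thesis .
    qed
    moreover have "(\<lambda>n. \<integral>\<omega>. \<xi> \<omega> * Y n \<omega> \<partial>M) \<longlonglongrightarrow> 0"
    proof (rule Lim_null_comparison)
      show "\<forall>\<^sub>F n in sequentially. norm (\<integral>\<omega>. \<xi> \<omega> * Y n \<omega> \<partial>M)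
          \<le> sqrt ((\<integral>\<omega>. (\<xi> \<omega>)\<^sup>2 \<partial>M) * (\<integral>\<omega>. (Y n \<omega>)\<^sup>2 \<partial>M))"
        using Cauchy_Schwarz_integral[OF \<xi>(1) hypercontractive_measurable[OF H Y] \<xi>(2)
            hypercontractive_integrable_square[OF H Y]]
        by (intro always_eventually allI real_le_rsqrt) simp
      have "(\<lambda>n. Y n \<omega>) \<longlonglongrightarrow> 0" if "\<omega> \<in> space M" for \<omega>
        using tendsto_inner[OF tendsto_const[of b] lim[OF that]]
        unfolding Y_def by (rule LIM_zero)
      from tendsto_real_sqrt[OF tendsto_mult[OF tendsto_const[of "\<integral>\<omega>. (\<xi> \<omega>)\<^sup>2 \<partial>M"]
            hypercontractive_L2_tendsto_zero[OF H Y this]]]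
      show "(\<lambda>n. sqrt ((\<integral>\<omega>. (\<xi> \<omega>)\<^sup>2 \<partial>M) * (\<integral>\<omega>. (Y n \<omega>)\<^sup>2 \<partial>M))) \<longlonglongrightarrow> 0"
        by simp
    qed
    ultimately show ?thesis
      by simp
  qed
  then have "(\<lambda>n. (\<integral>\<omega>. \<xi> \<omega> *\<^sub>R F n \<omega> \<partial>M) - (\<integral>\<omega>. \<xi> \<omega> *\<^sub>R G \<omega> \<partial>M)) \<longlonglongrightarrow> 0"
    by (subst tendsto_componentwise_iff) simp
  then show ?thesis
    by (simp add: LIM_zero_iff)
qed

end

section \<open>Congruence and extension of Jacobians\<close>

text \<open>Differentiability is demanded only on \<open>interior D\<close>, an open set on which
  \<open>v\<close> and \<open>w\<close> agree, so the derivatives there coincide.\<close>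

lemma has_C1_jacobian_cong:
  assumes "\<And>x. x \<in> D \<Longrightarrow> v x = w x"
  shows "has_C1_jacobian D v J \<longleftrightarrow> has_C1_jacobian D w J"
proof -
  have "(v has_derivative T) (at x) \<longleftrightarrow> (w has_derivative T) (at x)" if "x \<in> interior D" for x T
    using assms interior_subset[of D]
      has_derivative_transform_within_open[OF _ open_interior that, of v T _ w]
      has_derivative_transform_within_open[OF _ open_interior that, of w T _ v]
    by (metis subsetD)
  then show ?thesis
    unfolding has_C1_jacobian_def using assms by (simp cong: continuous_on_cong)
qed

text \<open>The kernel of \<open>L\<close> is a subspace, hence convex and nonempty, so Dugundji's
  extension of \<open>V\<close> from the closed set \<open>closure (interior D)\<close> to
  \<open>D\<close> can take its values in that kernel. It agrees with \<open>V\<close> on the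
  interior and therefore still represents the derivative.\<close>

lemma has_C1_jacobian_extend:
  fixes L :: "real^'n^'n \<Rightarrow> 'b::real_vector"
  assumes "closed D" "linear L"
    and v: "continuous_on D v" and V: "continuous_on (closure (interior D)) V"
    and deriv: "\<And>x. x \<in> interior D \<Longrightarrow> (v has_derivative (\<lambda>h. V x *v h)) (at x)"
    and zero: "\<And>x. x \<in> closure (interior D) \<Longrightarrow> L (V x) = 0"
  shows "\<exists>J. has_C1_jacobian D v J \<and> (\<forall>x\<in>D. L (J x) = 0)"
proof -
  have "convex {A. L A = 0}"
    using \<open>linear L\<close> by (simp add: convex_def linear_add linear_scale)
  moreover have "{A. L A = 0} \<noteq> {}"
    using linear_0[OF \<open>linear L\<close>] by blast
  moreover have "closedin (top_of_set D) (closure (interior D))"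
    using \<open>closed D\<close> by (simp add: closed_subset closure_minimal interior_subset)
  moreover have "V ` closure (interior D) \<subseteq> {A. L A = 0}"
    using zero by blast
  ultimately obtain J where J: "continuous_on D J" "J ` D \<subseteq> {A. L A = 0}"
    "\<And>x. x \<in> closure (interior D) \<Longrightarrow> J x = V x"
    using V by (metis Dugundji)
  have "has_C1_jacobian D v J"
    unfolding has_C1_jacobian_def
    using J deriv v closure_subset[of "interior D"] by (auto simp: subset_iff)
  with J show ?thesis
    by blast
qed

lemma linear_matrix_vector_mult_left: "linear (\<lambda>A :: real^'n^'m. A *v h)"
  by (rule linearI) (simp_all add: matrix_vector_mult_add_rdistrib scaleR_matrix_vector_assoc)

lemma matrix_Basis_inner:
  assumes "b \<in> (Basis :: (real^'n^'m) set)"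
  shows "\<exists>i j. \<forall>A. A \<bullet> b = A $ i $ j"
proof -
  from assms obtain i u where b: "b = axis i u" "u \<in> Basis"
    by (auto simp: Basis_vec_def)
  then obtain j where "u = axis j 1"
    by (auto simp: Basis_vec_def)
  with b show ?thesis
    by (auto simp: inner_axis)
qed

lemma integrable_vec_nth:
  fixes f :: "'a \<Rightarrow> real^'n"
  shows "integrable M f \<Longrightarrow> integrable M (\<lambda>\<omega>. f \<omega> $ i)"
  by (rule integrable_bounded_linear[OF bounded_linear_vec_nth])

lemma vector_in_linear_functionals:
  assumes "x \<in> D"
  shows "vector_in (linear_functionals D f) (\<lambda>\<omega>. f \<omega> x)"
  unfolding vector_in_def linear_functionals_def
  by (auto intro!: exI[of _ "{x}"] exI[of _ "\<lambda>_. _"] assms)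

lemma gaussian_process_measurable:
  assumes "gaussian_process M D g" "x \<in> D"
  shows "(\<lambda>\<omega>. g \<omega> x) \<in> borel_measurable M"
proof -
  have "jointly_gaussian M {x} (\<lambda>x \<omega>. g \<omega> x)"
    using assms by (simp add: gaussian_process_def)
  then show ?thesis
    by (simp add: jointly_gaussian_def)
qed

section \<open>Path derivatives and differentiation under the expectation\<close>

context prob_space
begin

text \<open>The entry in row \<open>i\<close> and column \<open>k\<close> is component
  \<open>i\<close> of the derivative along axis \<open>k\<close>, hence a pointwise limit of
  difference quotients. Each quotient combines two values of \<open>f\<close> and so has its
  components in \<open>H\<close>.\<close>

lemma vector_in_jacobian:
  fixes f :: "'a \<Rightarrow> real^'n \<Rightarrow> real^'n"
  assumes H: "hypercontractive_space M (limit_closure M H)"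
    and f: "\<And>x. x \<in> D \<Longrightarrow> vector_in H (\<lambda>\<omega>. f \<omega> x)" and H0: "hypercontractive_space M H"
    and J: "\<And>\<omega>. \<omega> \<in> space M \<Longrightarrow> (f \<omega> has_derivative (\<lambda>h. J \<omega> *v h)) (at x)"
    and x: "x \<in> interior D"
  shows "vector_in (limit_closure M H) J"
proof (rule vector_in_Basis[OF H])
  fix b :: "real^'n^'n" assume "b \<in> Basis"
  then obtain i k where b: "\<And>A. A \<bullet> b = A $ i $ k"
    using matrix_Basis_inner by blast
  define h :: "real^'n" where "h = axis k 1"
  from x obtain e where e: "e > 0" "cball x e \<subseteq> D"
    by (auto simp: mem_interior_cball)
  \<comment> \<open>The bound \<open>t n \<le> e\<close> keeps \<open>x + t n *\<^sub>R h\<close> in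
    the ball inside \<open>D\<close>; \<open>Suc\<close> keeps the divisor positive, so every
    \<open>t n\<close> is nonzero.\<close>
  define t where "t n = e / real (Suc n)" for n
  have t: "0 < t n" "t n \<le> e" for n
    using e by (auto simp: t_def field_simps)
  have "x + t n *\<^sub>R h \<in> D" for n
    using e(2) t[of n] by (auto simp: subset_iff h_def dist_norm)
  moreover have "x \<in> D"
    using x interior_subset by blast
  ultimately have quotient: "vector_in H (\<lambda>\<omega>. (1 / t n) *\<^sub>R (f \<omega> (x + t n *\<^sub>R h) - f \<omega> x))" for n
    using vector_in_lincomb[OF H0 f f, of "x + t n *\<^sub>R h" x "-1"]
    by (intro vector_in_linear[where T="\<lambda>y. (1 / t n) *\<^sub>R y"]) (auto intro: linear_scale_self)
  have "t \<longlonglongrightarrow> 0"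
    unfolding t_def by (rule LIMSEQ_Suc[OF lim_const_over_n])
  then have t_at: "filterlim t (at 0) sequentially"
    using t(1) by (auto simp: filterlim_at less_imp_neq[symmetric])
  have "vector_in (limit_closure M H) (\<lambda>\<omega>. J \<omega> *v h)"
  proof (rule vector_in_limit_closure[OF quotient])
    fix \<omega> assume "\<omega> \<in> space M"
    have "((\<lambda>t. f \<omega> (x + t *\<^sub>R h)) has_derivative (\<lambda>s. J \<omega> *v (s *\<^sub>R h))) (at 0)"
      by (rule has_derivative_compose[of "\<lambda>t. x + t *\<^sub>R h" _ _ _ "f \<omega>" "\<lambda>h. J \<omega> *v h"])
        (use J[OF \<open>\<omega> \<in> space M\<close>] in \<open>auto intro!: derivative_eq_intros\<close>)
    then have "((\<lambda>s. norm (f \<omega> (x + s *\<^sub>R h) - f \<omega> x - s *\<^sub>R (J \<omega> *v h)) / norm s) \<longlongrightarrow> 0) (at 0)"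
      by (simp add: has_derivative_at matrix_vector_mult_scaleR)
    also have "?this \<longleftrightarrow>
      ((\<lambda>s. norm ((1 / s) *\<^sub>R (f \<omega> (x + s *\<^sub>R h) - f \<omega> x) - J \<omega> *v h)) \<longlongrightarrow> 0) (at 0)"
    proof (rule LIM_cong[OF refl _ refl])
      fix s :: real assume "s \<noteq> 0"
      then have "(1 / s) *\<^sub>R (f \<omega> (x + s *\<^sub>R h) - f \<omega> x) - J \<omega> *v h
        = (1 / s) *\<^sub>R (f \<omega> (x + s *\<^sub>R h) - f \<omega> x - s *\<^sub>R (J \<omega> *v h))"
        by (simp add: scaleR_diff_right)
      then show "norm (f \<omega> (x + s *\<^sub>R h) - f \<omega> x - s *\<^sub>R (J \<omega> *v h)) / norm s
        = norm ((1 / s) *\<^sub>R (f \<omega> (x + s *\<^sub>R h) - f \<omega> x) - J \<omega> *v h)"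
        by simp
    qed
    finally have "((\<lambda>s. (1 / s) *\<^sub>R (f \<omega> (x + s *\<^sub>R h) - f \<omega> x)) \<longlongrightarrow> J \<omega> *v h) (at 0)"
      by (rule LIM_zero_cancel[OF tendsto_norm_zero_cancel])
    then show "(\<lambda>n. (1 / t n) *\<^sub>R (f \<omega> (x + t n *\<^sub>R h) - f \<omega> x)) \<longlonglongrightarrow> J \<omega> *v h"
      using t_at by (rule filterlim_compose)
  qed
  then have "(\<lambda>\<omega>. axis i 1 \<bullet> (J \<omega> *v h)) \<in> limit_closure M H"
    by (simp add: vector_in_def)
  then show "(\<lambda>\<omega>. J \<omega> \<bullet> b) \<in> limit_closure M H"
    by (simp add: b h_def inner_axis' matrix_vector_mult_basis column_def)
qed

lemma integral_vector_in_linear: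
  fixes F :: "'a \<Rightarrow> 'b::euclidean_space" and T :: "'b \<Rightarrow> 'c::euclidean_space"
  assumes "hypercontractive_space M H" "vector_in H F" "linear T"
    and "\<xi> \<in> borel_measurable M" "integrable M (\<lambda>\<omega>. (\<xi> \<omega>)\<^sup>2)"
  shows "(\<integral>\<omega>. \<xi> \<omega> *\<^sub>R T (F \<omega>) \<partial>M) = T (\<integral>\<omega>. \<xi> \<omega> *\<^sub>R F \<omega> \<partial>M)"
  using integral_bounded_linear[OF linear_conv_bounded_linear[THEN iffD1, OF assms(3)]
      vector_in_integrable[OF assms(1,2,4,5)]]
  by (simp add: linear_scale[OF assms(3)])

text \<open>The weight \<open>\<xi>\<close> covers the mean and the covariance columns at once, and
  \<open>L\<close> covers divergence and both curls. The new Jacobian is the weighted expectation of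
  the path Jacobians, and linearity lets \<open>L\<close> pass under the integral.\<close>

lemma gaussian_process_expectation_jacobian:
  fixes g :: "'a \<Rightarrow> real^'n \<Rightarrow> real^'n" and L :: "real^'n^'n \<Rightarrow> 'b::euclidean_space"
  assumes "closed D" and g: "gaussian_process M D g" and L: "linear L"
    and ae: "AE \<omega> in M. \<exists>J. has_C1_jacobian D (g \<omega>) J \<and> (\<forall>x\<in>D. L (J x) = 0)"
    and \<xi>: "\<xi> \<in> borel_measurable M" "integrable M (\<lambda>\<omega>. (\<xi> \<omega>)\<^sup>2)"
  shows "\<exists>J. has_C1_jacobian D (\<lambda>x. \<integral>\<omega>. \<xi> \<omega> *\<^sub>R g \<omega> x \<partial>M) J \<and> (\<forall>x\<in>D. L (J x) = 0)"
proof -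
  from ae obtain N where N: "N \<in> null_sets M"
    and good: "\<And>\<omega>. \<omega> \<in> space M - N \<Longrightarrow> \<exists>J. has_C1_jacobian D (g \<omega>) J \<and> (\<forall>x\<in>D. L (J x) = 0)"
    by (auto elim!: AE_E3)
  have [measurable]: "N \<in> sets M"
    using N by auto
  \<comment> \<open>The zero field is a safe value on the null set: it has Jacobian 0, which every
    linear \<open>L\<close> annihilates.\<close>
  define f where "f \<omega> x = (if \<omega> \<in> N then 0 else g \<omega> x)" for \<omega> x
  have fg: "AE \<omega> in M. f \<omega> = g \<omega>"
    using AE_not_in[OF N] by eventually_elim (simp add: f_def fun_eq_iff)
  have g_meas: "(\<lambda>\<omega>. g \<omega> x) \<in> borel_measurable M" if "x \<in> D" for x
    by (rule gaussian_process_measurable[OF g that])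
  have f_meas: "(\<lambda>\<omega>. f \<omega> x) \<in> borel_measurable M" if "x \<in> D" for x
    unfolding f_def using g_meas[OF that] by measurable
  have "\<exists>J. has_C1_jacobian D (f \<omega>) J \<and> (\<forall>x\<in>D. L (J x) = 0)" if "\<omega> \<in> space M" for \<omega>
  proof (cases "\<omega> \<in> N")
    case True
    then show ?thesis
      using linear_0[OF L] by (intro exI[of _ "\<lambda>_. 0"]) (simp add: f_def[abs_def] has_C1_jacobian_def)
  next
    case False
    then show ?thesis
      using good[of \<omega>] that by (simp add: f_def[abs_def])
  qed
  \<comment> \<open>The Jacobians are chosen separately for each \<open>\<omega>\<close>, so nothing
    is known yet about measurability in \<open>\<omega>\<close>. It comes from membership in
    \<open>H1\<close> or \<open>H2\<close>, on \<open>closure (interior D)\<close> only.\<close>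
  then obtain J where J: "\<And>\<omega>. \<omega> \<in> space M \<Longrightarrow> has_C1_jacobian D (f \<omega>) (J \<omega>)"
    and LJ: "\<And>\<omega> x. \<omega> \<in> space M \<Longrightarrow> x \<in> D \<Longrightarrow> L (J \<omega> x) = 0"
    by metis
  \<comment> \<open>\<open>H0\<close> serves the values of \<open>f\<close>, \<open>H1\<close> adds
    the derivatives at interior points, and \<open>H2\<close> those at points of
    \<open>closure (interior D)\<close>.\<close>
  define H0 where "H0 = linear_functionals D f"
  define H1 where "H1 = limit_closure M H0"
  define H2 where "H2 = limit_closure M H1"
  have H0: "hypercontractive_space M H0"
    unfolding H0_def by (rule hypercontractive_linear_functionals[OF g fg f_meas])
  have H1: "hypercontractive_space M H1"
    unfolding H1_def by (rule hypercontractive_limit_closure[OF H0])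
  have H2: "hypercontractive_space M H2"
    unfolding H2_def by (rule hypercontractive_limit_closure[OF H1])
  have f0: "vector_in H0 (\<lambda>\<omega>. f \<omega> x)" if "x \<in> D" for x
    unfolding H0_def by (rule vector_in_linear_functionals[OF that])
  have f1: "vector_in H1 (\<lambda>\<omega>. f \<omega> x)" if "x \<in> D" for x
    using vector_in_mono[OF f0[OF that] subset_limit_closure] by (simp add: H1_def)
  have int_D: "interior D \<subseteq> D" and C_D: "closure (interior D) \<subseteq> D"
    using \<open>closed D\<close> by (simp_all add: interior_subset closure_minimal)
  have deriv: "(f \<omega> has_derivative (\<lambda>h. J \<omega> x *v h)) (at x)"
    if "\<omega> \<in> space M" "x \<in> interior D" for \<omega> x
    using J that by (simp add: has_C1_jacobian_def)
  have J1: "vector_in H1 (\<lambda>\<omega>. J \<omega> x)" if "x \<in> interior D" for x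
    unfolding H1_def by (rule vector_in_jacobian[OF _ f0 H0 deriv[OF _ that] that]) (use H1 H1_def in auto)
  have lim_J: "(\<lambda>n. J \<omega> (u n)) \<longlonglongrightarrow> J \<omega> x"
    if "\<omega> \<in> space M" "\<And>n. u n \<in> D" "x \<in> D" "u \<longlonglongrightarrow> x" for u x \<omega>
    using J[OF that(1)] that by (auto simp: has_C1_jacobian_def continuous_on_sequentially o_def)
  have lim_f: "(\<lambda>n. f \<omega> (u n)) \<longlonglongrightarrow> f \<omega> x"
    if "\<omega> \<in> space M" "\<And>n. u n \<in> D" "x \<in> D" "u \<longlonglongrightarrow> x" for u x \<omega>
    using J[OF that(1)] that by (auto simp: has_C1_jacobian_def continuous_on_sequentially o_def)
  \<comment> \<open>Such a point is a limit of interior points \<open>u n\<close>, and each path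
    Jacobian is continuous on \<open>D\<close>; this costs the second limit closure.\<close>
  have J2: "vector_in H2 (\<lambda>\<omega>. J \<omega> x)" if x: "x \<in> closure (interior D)" for x
  proof -
    from x obtain u where u: "\<And>n. u n \<in> interior D" "u \<longlonglongrightarrow> x"
      by (auto simp: closure_sequential)
    show ?thesis
      unfolding H2_def
      by (rule vector_in_limit_closure[OF J1[OF u(1)] lim_J]) (use u x int_D C_D in auto)
  qed
  define v where "v x = (\<integral>\<omega>. \<xi> \<omega> *\<^sub>R f \<omega> x \<partial>M)" for x
  define V where "V x = (\<integral>\<omega>. \<xi> \<omega> *\<^sub>R J \<omega> x \<partial>M)" for x
  have "\<exists>J. has_C1_jacobian D v J \<and> (\<forall>x\<in>D. L (J x) = 0)"
  proof (rule has_C1_jacobian_extend[OF \<open>closed D\<close> L])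
    show "continuous_on D v"
      unfolding v_def
      by (intro continuous_on_sequentiallyI tendsto_integral_vector_in[OF H0] f0 \<xi> lim_f) auto
    show "continuous_on (closure (interior D)) V"
      unfolding V_def
      by (intro continuous_on_sequentiallyI tendsto_integral_vector_in[OF H2] J2 \<xi> lim_J)
        (use C_D in auto)
    show "L (V x) = 0" if "x \<in> closure (interior D)" for x
    proof -
      have "L (V x) = (\<integral>\<omega>. \<xi> \<omega> *\<^sub>R L (J \<omega> x) \<partial>M)"
        unfolding V_def by (rule integral_vector_in_linear[OF H2 J2[OF that] L \<xi>, symmetric])
      also have "\<dots> = (\<integral>\<omega>. 0 \<partial>M)"
        using that C_D LJ by (intro Bochner_Integration.integral_cong) auto
      finally show ?thesis
        by simp
    qed
    show "(v has_derivative (\<lambda>h. V x *v h)) (at x)" if x: "x \<in> interior D" for x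
    proof -
      \<comment> \<open>The normalised Taylor remainder of \<open>v\<close> is tested along
        sequences. It equals the weighted expectation of the remainder \<open>F n\<close> of the
        paths, which belongs to \<open>H1\<close> and tends to 0 pointwise. Restricting to
        \<open>interior D\<close> keeps the points \<open>X n\<close> where \<open>f\<close> is
        controlled, and openness later recovers the full derivative.\<close>
      have "((\<lambda>y. (1 / norm (y - x)) *\<^sub>R (v y - (v x + V x *v (y - x)))) \<longlongrightarrow> 0) (at x within interior D)"
        unfolding tendsto_at_iff_sequentially
      proof (intro allI impI)
        fix X assume X: "\<forall>i. X i \<in> interior D - {x}" "X \<longlonglongrightarrow> x"
        define F where "F n \<omega> =
          (1 / norm (X n - x)) *\<^sub>R (f \<omega> (X n) - (f \<omega> x + J \<omega> x *v (X n - x)))" for n \<omega>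
        have Jv: "vector_in H1 (\<lambda>\<omega>. J \<omega> x *v h)" for h
          by (rule vector_in_linear[OF J1[OF x] linear_matrix_vector_mult_left])
        have F: "vector_in H1 (F n)" for n
        proof -
          have "vector_in H1 (\<lambda>\<omega>. (f \<omega> (X n) + (-1) *\<^sub>R f \<omega> x) + (-1) *\<^sub>R (J \<omega> x *v (X n - x)))"
            using X x int_D by (intro vector_in_lincomb[OF H1] Jv f1) auto
          then have "vector_in H1 (\<lambda>\<omega>. (1 / norm (X n - x)) *\<^sub>R
            ((f \<omega> (X n) + (-1) *\<^sub>R f \<omega> x) + (-1) *\<^sub>R (J \<omega> x *v (X n - x))))"
            by (rule vector_in_linear) (rule linear_scale_self)
          then show ?thesis
            by (simp add: F_def[abs_def] diff_diff_eq)
        qed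
        have "(\<lambda>n. F n \<omega>) \<longlonglongrightarrow> 0" if "\<omega> \<in> space M" for \<omega>
          using has_derivative_at_withinI[OF deriv[OF that x], of "interior D"] X
          unfolding has_derivative_within tendsto_at_iff_sequentially F_def o_def by blast
        then have "(\<lambda>n. \<integral>\<omega>. \<xi> \<omega> *\<^sub>R F n \<omega> \<partial>M) \<longlonglongrightarrow> (\<integral>\<omega>. \<xi> \<omega> *\<^sub>R 0 \<partial>M)"
          by (intro tendsto_integral_vector_in[OF H1] F \<xi>)
            (use H1 in \<open>auto simp: vector_in_def hypercontractive_space_def\<close>)
        moreover have "(\<integral>\<omega>. \<xi> \<omega> *\<^sub>R F n \<omega> \<partial>M) =
          (1 / norm (X n - x)) *\<^sub>R (v (X n) - (v x + V x *v (X n - x)))" for n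
        proof -
          have [simp]: "integrable M (\<lambda>\<omega>. \<xi> \<omega> *\<^sub>R f \<omega> (X n))" "integrable M (\<lambda>\<omega>. \<xi> \<omega> *\<^sub>R f \<omega> x)"
            "integrable M (\<lambda>\<omega>. \<xi> \<omega> *\<^sub>R (J \<omega> x *v (X n - x)))"
            using X x int_D by (auto intro!: vector_in_integrable[OF H1] f1 Jv \<xi>)
          have "(\<integral>\<omega>. \<xi> \<omega> *\<^sub>R F n \<omega> \<partial>M) = (\<integral>\<omega>. (1 / norm (X n - x)) *\<^sub>R (\<xi> \<omega> *\<^sub>R f \<omega> (X n)
              - (\<xi> \<omega> *\<^sub>R f \<omega> x + \<xi> \<omega> *\<^sub>R (J \<omega> x *v (X n - x)))) \<partial>M)"
            by (simp add: F_def algebra_simps)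
          also have "\<dots> = (1 / norm (X n - x)) *\<^sub>R (v (X n) - (v x +
              (\<integral>\<omega>. \<xi> \<omega> *\<^sub>R (J \<omega> x *v (X n - x)) \<partial>M)))"
            by (simp add: v_def)
          also have "(\<integral>\<omega>. \<xi> \<omega> *\<^sub>R (J \<omega> x *v (X n - x)) \<partial>M) = V x *v (X n - x)"
            unfolding V_def
            by (rule integral_vector_in_linear[OF H1 J1[OF x] linear_matrix_vector_mult_left \<xi>])
          finally show ?thesis .
        qed
        ultimately show "((\<lambda>y. (1 / norm (y - x)) *\<^sub>R (v y - (v x + V x *v (y - x)))) \<circ> X) \<longlonglongrightarrow> 0"
          by (simp add: o_def)
      qed
      then have "(v has_derivative (\<lambda>h. V x *v h)) (at x within interior D)"
        by (simp add: has_derivative_within)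
      then show ?thesis
        unfolding at_within_open[OF x open_interior] .
    qed
  qed
  \<comment> \<open>Measurability of \<open>g \<omega> x\<close> in \<open>\<omega>\<close> is
    available for \<open>x\<close> in \<open>D\<close> only, so the two fields are compared on
    \<open>D\<close> and \<open>has_C1_jacobian_cong\<close> does the rest.\<close>
  moreover have "(\<integral>\<omega>. \<xi> \<omega> *\<^sub>R g \<omega> x \<partial>M) = v x" if "x \<in> D" for x
    unfolding v_def
  proof (rule integral_cong_AE)
    show "AE \<omega> in M. \<xi> \<omega> *\<^sub>R g \<omega> x = \<xi> \<omega> *\<^sub>R f \<omega> x"
      using fg by eventually_elim simp
  qed (use \<xi> g_meas[OF that] f_meas[OF that] in measurable)
  ultimately show ?thesis
    using has_C1_jacobian_cong[of D "\<lambda>x. \<integral>\<omega>. \<xi> \<omega> *\<^sub>R g \<omega> x \<partial>M" v] by simp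
qed

section \<open>Covariance columns as weighted expectations\<close>

lemma gaussian_process_integrable:
  fixes g :: "'a \<Rightarrow> real^'n \<Rightarrow> real^'n"
  assumes g: "gaussian_process M D g" and x: "x \<in> D"
  shows "integrable M (\<lambda>\<omega>. g \<omega> x)" "integrable M (\<lambda>\<omega>. ((g \<omega> x - a) $ i)\<^sup>2)"
proof -
  have H: "hypercontractive_space M (linear_functionals D g)"
    by (rule hypercontractive_linear_functionals[OF g _ gaussian_process_measurable[OF g]]) auto
  note gx = vector_in_linear_functionals[OF x, of g]
  show int: "integrable M (\<lambda>\<omega>. g \<omega> x)"
    using vector_in_integrable[OF H gx, of "\<lambda>_. 1"] by simp
  have "(\<lambda>\<omega>. axis i 1 \<bullet> g \<omega> x) \<in> linear_functionals D g"
    using gx by (simp add: vector_in_def)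
  then have sq: "integrable M (\<lambda>\<omega>. (g \<omega> x $ i)\<^sup>2)"
    using hypercontractive_integrable_square[OF H] by (simp add: inner_axis')
  have "integrable M (\<lambda>\<omega>. g \<omega> x $ i)"
    using int by (rule integrable_vec_nth)
  with sq show "integrable M (\<lambda>\<omega>. ((g \<omega> x - a) $ i)\<^sup>2)"
    by (simp add: power2_diff)
qed

text \<open>Only the factor at \<open>x'\<close> has to stay centred: the product with the constant
  vector \<open>gp_mean M g x\<close> integrates to 0 because the weight has mean 0. The column thus
  takes the form treated by \<open>gaussian_process_expectation_jacobian\<close>.\<close>

lemma column_gp_cov:
  fixes g :: "'a \<Rightarrow> real^'n \<Rightarrow> real^'n"
  assumes g: "gaussian_process M D g" and x: "x \<in> D" and x': "x' \<in> D"
  shows "column j (gp_cov M g x x') =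
    (\<integral>\<omega>. ((g \<omega> x' - gp_mean M g x') $ j) *\<^sub>R g \<omega> x \<partial>M)"
proof -
  define \<xi> where "\<xi> \<omega> = (g \<omega> x' - gp_mean M g x') $ j" for \<omega>
  note gint = gaussian_process_integrable[OF g]
  have comp_meas: "(\<lambda>\<omega>. (g \<omega> y - a) $ i) \<in> borel_measurable M" if "y \<in> D" for y a i
    using gint(1)[OF that] by (intro borel_measurable_integrable integrable_vec_nth) simp
  \<comment> \<open>The shifts \<open>a\<close> and \<open>b\<close> are left free: both are means
    for the kernel, while \<open>a = 0\<close> gives the uncentred integrand of the claim.\<close>
  have prod: "integrable M (\<lambda>\<omega>. (g \<omega> x - a) $ i * (g \<omega> x' - b) $ k)" for a b i k
    by (intro integrable_mult_of_squares comp_meas gint x x')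
  have int: "integrable M (\<lambda>\<omega>. (g \<omega> x' - b) $ k *\<^sub>R (g \<omega> x - a))" for a b k
  proof -
    have "integrable M (\<lambda>\<omega>. \<Sum>c\<in>Basis. ((g \<omega> x' - b) $ k *\<^sub>R (g \<omega> x - a) \<bullet> c) *\<^sub>R c)"
    proof (intro Bochner_Integration.integrable_sum integrable_scaleR_left)
      fix c :: "real^'n" assume "c \<in> Basis"
      then obtain i where "c = axis i 1"
        by (auto simp: Basis_vec_def)
      then show "integrable M (\<lambda>\<omega>. (g \<omega> x' - b) $ k *\<^sub>R (g \<omega> x - a) \<bullet> c)"
        using prod[of a i b k] by (simp add: inner_axis mult.commute)
    qed
    then show ?thesis
      by (simp only: euclidean_representation)
  qed
  let ?K = "\<lambda>\<omega>. \<chi> i j. (g \<omega> x - gp_mean M g x) $ i * (g \<omega> x' - gp_mean M g x') $ j"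
  have "integrable M (\<lambda>\<omega>. \<Sum>c\<in>Basis. (?K \<omega> \<bullet> c) *\<^sub>R c)"
  proof (intro Bochner_Integration.integrable_sum integrable_scaleR_left)
    fix c :: "real^'n^'n" assume "c \<in> Basis"
    then obtain i k where "\<And>A. A \<bullet> c = A $ i $ k"
      using matrix_Basis_inner by blast
    then show "integrable M (\<lambda>\<omega>. ?K \<omega> \<bullet> c)"
      using prod by simp
  qed
  then have K: "integrable M ?K"
    by (simp only: euclidean_representation)
  have "linear (column j :: real^'n^'n \<Rightarrow> _)"
    by (rule linearI) (simp_all add: column_def vec_eq_iff)
  then have "bounded_linear (column j :: real^'n^'n \<Rightarrow> _)"
    by (simp only: linear_conv_bounded_linear)
  from integral_bounded_linear[OF this K]
  have "column j (gp_cov M g x x') = (\<integral>\<omega>. column j (?K \<omega>) \<partial>M)"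
    unfolding gp_cov_def by (rule sym)
  also have "\<dots> = (\<integral>\<omega>. \<xi> \<omega> *\<^sub>R (g \<omega> x - gp_mean M g x) \<partial>M)"
    by (intro Bochner_Integration.integral_cong refl)
      (simp add: column_def vec_eq_iff \<xi>_def mult.commute)
  also have "\<dots> = (\<integral>\<omega>. \<xi> \<omega> *\<^sub>R g \<omega> x \<partial>M) - (\<integral>\<omega>. \<xi> \<omega> \<partial>M) *\<^sub>R gp_mean M g x"
  proof -
    have "integrable M (\<lambda>\<omega>. \<xi> \<omega> *\<^sub>R g \<omega> x)"
      using int[of "gp_mean M g x'" j 0] by (simp add: \<xi>_def)
    moreover have "integrable M \<xi>"
      unfolding \<xi>_def using gint(1)[OF x']
      by (intro integrable_vec_nth) simp
    ultimately show ?thesis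
      by (simp add: scaleR_diff_right)
  qed
  also have "(\<integral>\<omega>. \<xi> \<omega> \<partial>M) = 0"
  proof -
    have "(\<integral>\<omega>. \<xi> \<omega> \<partial>M) = (\<integral>\<omega>. g \<omega> x' - gp_mean M g x' \<partial>M) $ j"
      unfolding \<xi>_def using gint(1)[OF x']
      by (intro integral_bounded_linear[OF bounded_linear_vec_nth]) auto
    also have "\<dots> = 0"
      using gint(1)[OF x'] by (simp add: gp_mean_def prob_space)
    finally show ?thesis .
  qed
  finally show ?thesis
    by (simp add: \<xi>_def)
qed

text \<open>Two choices of the weight: the constant 1 yields the mean, and component
  \<open>j\<close> of the centred value at \<open>x'\<close>, which is square integrable, yields
  column \<open>j\<close> of the kernel.\<close>

lemma gaussian_process_mean_cov_jacobian:
  fixes g :: "'a \<Rightarrow> real^'n \<Rightarrow> real^'n" and L :: "real^'n^'n \<Rightarrow> 'b::euclidean_space"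
  assumes "compact D" and g: "gaussian_process M D g" and L: "linear L"
    and ae: "AE \<omega> in M. \<exists>J. has_C1_jacobian D (g \<omega>) J \<and> (\<forall>x\<in>D. L (J x) = 0)"
  shows "\<exists>J. has_C1_jacobian D (gp_mean M g) J \<and> (\<forall>x\<in>D. L (J x) = 0)"
    and "x' \<in> D \<Longrightarrow>
      \<exists>J. has_C1_jacobian D (\<lambda>x. column j (gp_cov M g x x')) J \<and> (\<forall>x\<in>D. L (J x) = 0)"
proof -
  note * = gaussian_process_expectation_jacobian[OF compact_imp_closed[OF \<open>compact D\<close>] g L ae]
  show "\<exists>J. has_C1_jacobian D (gp_mean M g) J \<and> (\<forall>x\<in>D. L (J x) = 0)"
    using *[of "\<lambda>_. 1"] by (simp add: gp_mean_def[abs_def])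
  assume x': "x' \<in> D"
  have "(\<lambda>\<omega>. (g \<omega> x' - gp_mean M g x') $ j) \<in> borel_measurable M"
    using gaussian_process_integrable(1)[OF g x']
    by (intro borel_measurable_integrable integrable_vec_nth) simp
  from *[OF this gaussian_process_integrable(2)[OF g x']]
  show "\<exists>J. has_C1_jacobian D (\<lambda>x. column j (gp_cov M g x x')) J \<and> (\<forall>x\<in>D. L (J x) = 0)"
    using has_C1_jacobian_cong[OF column_gp_cov[OF g _ x']] by simp
qed

end

section \<open>Divergence and curl as linear conditions on the Jacobian\<close>

lemma linear_jac_div: "linear jac_div"
  by (rule linearI) (simp_all add: jac_div_def sum.distrib sum_distrib_left)

lemma linear_jac_curl2: "linear jac_curl2"
  by (rule linearI) (simp_all add: jac_curl2_def algebra_simps)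

lemma linear_jac_curl3: "linear jac_curl3"
  by (rule linearI) (simp_all add: jac_curl3_def vec_eq_iff forall_3 algebra_simps)

theorem lemma3p6:
  fixes M :: "'a measure"
  assumes "prob_space M"
  shows
    "(\<forall>(D :: (real^'n) set) (g :: 'a \<Rightarrow> real^'n \<Rightarrow> real^'n).
        compact D \<and> divergence_free_gp M D g \<longrightarrow>
          divergence_free D (gp_mean M g) \<and>
          (\<forall>x'\<in>D. \<forall>j. C1_on D (\<lambda>x. column j (gp_cov M g x x')) \<and>
             divergence_free D (\<lambda>x. column j (gp_cov M g x x')))) \<and>
     (\<forall>(D :: (real^2) set) (g :: 'a \<Rightarrow> real^2 \<Rightarrow> real^2).
        compact D \<and> rotation_free_gp2 M D g \<longrightarrow>
          rotation_free2 D (gp_mean M g) \<and>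
          (\<forall>x'\<in>D. \<forall>j. C1_on D (\<lambda>x. column j (gp_cov M g x x')) \<and>
             rotation_free2 D (\<lambda>x. column j (gp_cov M g x x')))) \<and>
     (\<forall>(D :: (real^3) set) (g :: 'a \<Rightarrow> real^3 \<Rightarrow> real^3).
        compact D \<and> rotation_free_gp3 M D g \<longrightarrow>
          rotation_free3 D (gp_mean M g) \<and>
          (\<forall>x'\<in>D. \<forall>j. C1_on D (\<lambda>x. column j (gp_cov M g x x')) \<and>
             rotation_free3 D (\<lambda>x. column j (gp_cov M g x x'))))"
proof -
  interpret prob_space M
    by fact
  show ?thesis
    unfolding divergence_free_gp_def rotation_free_gp2_def rotation_free_gp3_def C1_on_def
      divergence_free_def rotation_free2_def rotation_free3_def
  proof (intro conjI allI impI ballI; elim conjE)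
    fix D and g :: "'a \<Rightarrow> real^'n \<Rightarrow> real^'n" and x' j
    assume "compact D" "gaussian_process M D g"
      "AE \<omega> in M. \<exists>J. has_C1_jacobian D (g \<omega>) J \<and> (\<forall>x\<in>D. jac_div (J x) = 0)"
    note * = gaussian_process_mean_cov_jacobian[OF this(1,2) linear_jac_div this(3)]
    show "\<exists>J. has_C1_jacobian D (gp_mean M g) J \<and> (\<forall>x\<in>D. jac_div (J x) = 0)"
      by (rule *)
    assume "x' \<in> D"
    from *(2)[OF this, of j]
    show "\<exists>J. has_C1_jacobian D (\<lambda>x. column j (gp_cov M g x x')) J \<and> (\<forall>x\<in>D. jac_div (J x) = 0)"
      and "\<exists>J. has_C1_jacobian D (\<lambda>x. column j (gp_cov M g x x')) J"
      by blast+
  next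
    fix D and g :: "'a \<Rightarrow> real^2 \<Rightarrow> real^2" and x' j
    assume "compact D" "gaussian_process M D g"
      "AE \<omega> in M. \<exists>J. has_C1_jacobian D (g \<omega>) J \<and> (\<forall>x\<in>D. jac_curl2 (J x) = 0)"
    note * = gaussian_process_mean_cov_jacobian[OF this(1,2) linear_jac_curl2 this(3)]
    show "\<exists>J. has_C1_jacobian D (gp_mean M g) J \<and> (\<forall>x\<in>D. jac_curl2 (J x) = 0)"
      by (rule *)
    assume "x' \<in> D"
    from *(2)[OF this, of j]
    show "\<exists>J. has_C1_jacobian D (\<lambda>x. column j (gp_cov M g x x')) J \<and> (\<forall>x\<in>D. jac_curl2 (J x) = 0)"
      and "\<exists>J. has_C1_jacobian D (\<lambda>x. column j (gp_cov M g x x')) J"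
      by blast+
  next
    fix D and g :: "'a \<Rightarrow> real^3 \<Rightarrow> real^3" and x' j
    assume "compact D" "gaussian_process M D g"
      "AE \<omega> in M. \<exists>J. has_C1_jacobian D (g \<omega>) J \<and> (\<forall>x\<in>D. jac_curl3 (J x) = 0)"
    note * = gaussian_process_mean_cov_jacobian[OF this(1,2) linear_jac_curl3 this(3)]
    show "\<exists>J. has_C1_jacobian D (gp_mean M g) J \<and> (\<forall>x\<in>D. jac_curl3 (J x) = 0)"
      by (rule *)
    assume "x' \<in> D"
    from *(2)[OF this, of j]
    show "\<exists>J. has_C1_jacobian D (\<lambda>x. column j (gp_cov M g x x')) J \<and> (\<forall>x\<in>D. jac_curl3 (J x) = 0)"
      and "\<exists>J. has_C1_jacobian D (\<lambda>x. column j (gp_cov M g x x')) J"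
      by blast+
  qed
qed

end
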